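(* Consider the sparse signal in noise model: $S\in\{1,\dots,N\}$, $\mathcal{X}_S=\{\mathbf{x}\in\mathbb{R}^N:\|\mathbf{x}\|_0\le S\}$, $\sigma>0$, observation $\mathbf{y}=\mathbf{x}+\mathbf{n}\in\mathbb{R}^N$ with $\mathbf{n}\sim\mathcal{N}(\mathbf{0},\sigma^2\mathbf{I})$, $\mathbf{x}\in\mathcal{X}_S$, parameter function $g:\mathcal{X}_S\to\mathbb{R}$, and $\mathbf{x}_0\in\mathcal{X}_S$. Define $\nu_{\mathbf{x}_0}(\mathbf{x})=\exp\big(-\tfrac{1}{2\sigma^2}\|\mathbf{x}_0\|_2^2+\tfrac{1}{\sigma^2}\mathbf{x}^T\mathbf{x}_0\big)$ and $\psi_{\mathbf{x}_0}(\mathbf{x},\mathbf{y})=\exp\big(\tfrac{\mathbf{y}^T(\sigma\mathbf{x}-\mathbf{x}_0)}{\sigma^2}+\tfrac{\mathbf{x}_0^T\mathbf{x}}{\sigma}-\tfrac{\|\mathbf{x}\|_2^2}{2}\big)$. (1) A bias function $c:\mathcal{X}_S\to\mathbb{R}$ is valid at $\mathbf{x}_0$ if and only if $\gamma=c+g$ can be written as $\gamma(\mathbf{x})=\frac{1}{\nu_{\mathbf{x}_0}(\mathbf{x})}\sum_{\mathbf{p}\in\mathbb{Z}_+^N\cap\mathcal{X}_S}\frac{a[\mathbf{p}]}{\sqrt{\mathbf{p}!}}\big(\tfrac{\mathbf{x}}{\sigma}\big)^{\mathbf{p}}$ for all $\mathbf{x}\in\mathcal{X}_S$, with some $a\in\ell^2(\mathbb{Z}_+^N\cap\mathcal{X}_S)$;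 this sequence is unique for given $c$. (2) If $c$ is valid at $\mathbf{x}_0$, let $a_{\mathbf{x}_0}[\mathbf{p}]=\frac{1}{\sqrt{\mathbf{p}!}}\frac{\partial^{\mathbf{p}}(\gamma(\sigma\mathbf{x})\nu_{\mathbf{x}_0}(\sigma\mathbf{x}))}{\partial\mathbf{x}^{\mathbf{p}}}\big|_{\mathbf{x}=\mathbf{0}}$ for $\mathbf{p}\in\mathbb{Z}_+^N\cap\mathcal{X}_S$. Then (a) the minimum achievable variance at $\mathbf{x}_0$ is $M(c,\mathbf{x}_0)=\sum_{\mathbf{p}\in\mathbb{Z}_+^N\cap\mathcal{X}_S}a_{\mathbf{x}_0}^2[\mathbf{p}]-\gamma^2(\mathbf{x}_0)$; and (b) the LMV estimator at $\mathbf{x}_0$ is $$\hat g^{(c,\mathbf{x}_0)}(\mathbf{y})=\sum_{\mathbf{p}\in\mathbb{Z}_+^N\cap\mathcal{X}_S}\frac{a_{\mathbf{x}_0}[\mathbf{p}]}{\sqrt{\mathbf{p}!}}\frac{\partial^{\mathbf{p}}\psi_{\mathbf{x}_0}(\mathbf{x},\mathbf{y})}{\partial\mathbf{x}^{\mathbf{p}}}\Big|_{\mathbf{x}=\mathbf{0}}.$$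
   Context: $\mathbb{Z}_+^N\cap\mathcal{X}_S$ is the set of multi-indices $\mathbf{p}\in\mathbb{Z}_+^N$ with at most $S$ nonzero entries; $\mathbf{p}!=\prod p_l!$, $\mathbf{z}^{\mathbf{p}}=\prod z_l^{p_l}$, $\partial^{\mathbf{p}}/\partial\mathbf{x}^{\mathbf{p}}=\prod\partial^{p_l}/\partial x_l^{p_l}$. An estimator $\hat g:\mathbb{R}^N\to\mathbb{R}$ has bias $\mathsf{E}_{\mathbf{x}}\{\hat g(\mathbf{y})\}-g(\mathbf{x})$ and variance $v(\hat g;\mathbf{x})$. $c$ is valid at $\mathbf{x}_0$ if some estimator has finite variance at $\mathbf{x}_0$ and bias equal to $c$ on all of $\mathcal{X}_S$; $M(c,\mathbf{x}_0)$ is the infimum of $v(\hat g;\mathbf{x}_0)$ over such estimators; an LMV estimator is one attaining it. *)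

theory Defs
  imports "HOL-Probability.Probability"
begin

definition l0norm :: "real^'n \<Rightarrow> nat" where
  "l0norm x = card {i. x $ i \<noteq> 0}"

definition XS :: "nat \<Rightarrow> (real^'n) set" where
  "XS S = {x. l0norm x \<le> S}"

definition MI :: "nat \<Rightarrow> ('n::finite \<Rightarrow> nat) set" where
  "MI S = {p. card {i. p i \<noteq> 0} \<le> S}"

definition mfact :: "('n::finite \<Rightarrow> nat) \<Rightarrow> real" where
  "mfact p = (\<Prod>i\<in>UNIV. fact (p i))"

definition mpow :: "real^'n \<Rightarrow> ('n::finite \<Rightarrow> nat) \<Rightarrow> real" where
  "mpow z p = (\<Prod>i\<in>UNIV. (z $ i) ^ (p i))"

definition nu :: "real \<Rightarrow> real^'n \<Rightarrow> real^'n \<Rightarrow> real" where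
  "nu \<sigma> x0 x = exp (- (norm x0)\<^sup>2 / (2 * \<sigma>\<^sup>2) + (x \<bullet> x0) / \<sigma>\<^sup>2)"

definition psi :: "real \<Rightarrow> real^'n \<Rightarrow> real^'n \<Rightarrow> real^'n \<Rightarrow> real" where
  "psi \<sigma> x0 x y = exp ((y \<bullet> (\<sigma> *\<^sub>R x - x0)) / \<sigma>\<^sup>2 + (x0 \<bullet> x) / \<sigma> - (norm x)\<^sup>2 / 2)"

text \<open>Partial derivative in coordinate i, and the mixed partial derivative of
  multi-order p, obtained by applying d/dx_i exactly p i times for each i
  (in some fixed order).\<close>
definition partial :: "'n \<Rightarrow> (real^'n \<Rightarrow> real) \<Rightarrow> real^'n \<Rightarrow> real" where
  "partial i f = (\<lambda>x. deriv (\<lambda>t. f (x + t *\<^sub>R axis i 1)) 0)"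

definition dirs :: "('n::finite \<Rightarrow> nat) \<Rightarrow> 'n list" where
  "dirs p = (SOME l. \<forall>i. count_list l i = p i)"

definition mpartial :: "('n::finite \<Rightarrow> nat) \<Rightarrow> (real^'n \<Rightarrow> real) \<Rightarrow> real^'n \<Rightarrow> real" where
  "mpartial p f = foldr partial (dirs p) f"

definition gauss_pdf :: "real \<Rightarrow> real^'n \<Rightarrow> real^'n \<Rightarrow> real" where
  "gauss_pdf \<sigma> x y = (1 / sqrt (2 * pi * \<sigma>\<^sup>2)) ^ CARD('n) * exp (- (norm (y - x))\<^sup>2 / (2 * \<sigma>\<^sup>2))"

definition obs :: "real \<Rightarrow> real^'n \<Rightarrow> (real^'n) measure" where
  "obs \<sigma> x = density lborel (\<lambda>y. ennreal (gauss_pdf \<sigma> x y))"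

definition Ex :: "real \<Rightarrow> real^'n \<Rightarrow> (real^'n \<Rightarrow> real) \<Rightarrow> real" where
  "Ex \<sigma> x f = integral\<^sup>L (obs \<sigma> x) f"

definition var :: "real \<Rightarrow> real^'n \<Rightarrow> (real^'n \<Rightarrow> real) \<Rightarrow> real" where
  "var \<sigma> x f = Ex \<sigma> x (\<lambda>y. (f y)\<^sup>2) - (Ex \<sigma> x f)\<^sup>2"

definition admissible :: "real \<Rightarrow> nat \<Rightarrow> (real^'n \<Rightarrow> real) \<Rightarrow> (real^'n \<Rightarrow> real)
    \<Rightarrow> real^'n \<Rightarrow> (real^'n \<Rightarrow> real) \<Rightarrow> bool" where
  "admissible \<sigma> S g c x0 gh \<longleftrightarrow>
     gh \<in> borel_measurable borel \<and>
     integrable (obs \<sigma> x0) (\<lambda>y. (gh y)\<^sup>2) \<and>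
     (\<forall>x\<in>XS S. integrable (obs \<sigma> x) gh \<and> Ex \<sigma> x gh - g x = c x)"

definition valid :: "real \<Rightarrow> nat \<Rightarrow> (real^'n \<Rightarrow> real) \<Rightarrow> (real^'n \<Rightarrow> real) \<Rightarrow> real^'n \<Rightarrow> bool" where
  "valid \<sigma> S g c x0 \<longleftrightarrow> (\<exists>gh. admissible \<sigma> S g c x0 gh)"

definition Mvar :: "real \<Rightarrow> nat \<Rightarrow> (real^'n \<Rightarrow> real) \<Rightarrow> (real^'n \<Rightarrow> real) \<Rightarrow> real^'n \<Rightarrow> real" where
  "Mvar \<sigma> S g c x0 = Inf (var \<sigma> x0 ` {gh. admissible \<sigma> S g c x0 gh})"

definition LMV :: "real \<Rightarrow> nat \<Rightarrow> (real^'n \<Rightarrow> real) \<Rightarrow> (real^'n \<Rightarrow> real)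
    \<Rightarrow> real^'n \<Rightarrow> (real^'n \<Rightarrow> real) \<Rightarrow> bool" where
  "LMV \<sigma> S g c x0 gh \<longleftrightarrow> admissible \<sigma> S g c x0 gh \<and> var \<sigma> x0 gh = Mvar \<sigma> S g c x0"

definition rep :: "real \<Rightarrow> nat \<Rightarrow> (real^'n \<Rightarrow> real) \<Rightarrow> real^'n
    \<Rightarrow> (('n \<Rightarrow> nat) \<Rightarrow> real) \<Rightarrow> bool" where
  "rep \<sigma> S \<gamma> x0 a \<longleftrightarrow>
     (\<lambda>p. (a p)\<^sup>2) summable_on MI S \<and>
     (\<forall>x\<in>XS S. \<gamma> x = (1 / nu \<sigma> x0 x) *
        (\<Sum>\<^sub>\<infinity>p\<in>MI S. a p / sqrt (mfact p) * mpow ((1 / \<sigma>) *\<^sub>R x) p))"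

definition ax0 :: "real \<Rightarrow> (real^'n \<Rightarrow> real) \<Rightarrow> real^'n \<Rightarrow> ('n \<Rightarrow> nat) \<Rightarrow> real" where
  "ax0 \<sigma> \<gamma> x0 p = 1 / sqrt (mfact p) *
     mpartial p (\<lambda>x. \<gamma> (\<sigma> *\<^sub>R x) * nu \<sigma> x0 (\<sigma> *\<^sub>R x)) 0"

definition lmv_term :: "real \<Rightarrow> (real^'n \<Rightarrow> real) \<Rightarrow> real^'n \<Rightarrow> ('n \<Rightarrow> nat) \<Rightarrow> real^'n \<Rightarrow> real" where
  "lmv_term \<sigma> \<gamma> x0 p y = ax0 \<sigma> \<gamma> x0 p / sqrt (mfact p) * mpartial p (\<lambda>x. psi \<sigma> x0 x y) 0"

end

(* A function psi(x, .) is, up to the factor nu(sigma x), the likelihood ratio of the observation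
   at sigma x against the one at x0, so that nu(sigma x) E_{sigma x} h is the inner product of h and psi(x, .)
   in L^2 of the law at x0.  Substituting v = (y + x0) / sigma turns psi(x, .) into a weighted Hermite generating
   function; hence its derivatives at 0 are orthogonal with squared norms p!, and psi(x, .) is the sum of
   x^p / sqrt(p!) times the normalised derivatives.  A monomial with p outside MI S vanishes on XS S, so the
   mean function of h on XS S is a power series whose coefficients are the Hermite coefficients of h with
   index in MI S.  These are therefore determined by the bias and are mixed derivatives at 0; conversely
   every square-summable family of such coefficients is attained (Riesz-Fischer).  By Bessel's inequality the
   second moment is smallest exactly when all other Hermite coefficients vanish and h is the L^2 limit of its
   expansion over MI S. *)
theory Submission
  imports Defs
begin

section \<open>Orthonormal families of square-integrable functions\<close>

text \<open>The exact expansion of \<open>psi \<sigma> x0 x\<close> comes from a computation: its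
  squared norm and the sum of its squared Hermite coefficients both equal exp(|x|^2), and equality
  in Bessel's inequality forces the expansion to converge to it in L^2.

  The mixed derivatives meet a different obstacle. The bias fixes \<open>\<gamma>\<close> only on
  \<open>XS S\<close>, which has empty interior when S < N. A derivative whose order p lies in
  \<open>MI S\<close>, taken at 0, consults only points supported where p is nonzero, and these all
  lie in \<open>XS S\<close>. There the function agrees with an entire series on the whole space,
  which may be differentiated term by term.

  Multi-indices carry no preferred order, so sums are unordered and L^2 limits run along finite
  index sets; a sequence is extracted only where an almost-everywhere limit is required.\<close>

definition sq_integrable :: "'a measure \<Rightarrow> ('a \<Rightarrow> real) \<Rightarrow> bool" where
  "sq_integrable M f \<longleftrightarrow> f \<in> borel_measurable M \<and> integrable M (\<lambda>x. (f x)\<^sup>2)"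

lemma sq_integrableD:
  assumes "sq_integrable M f"
  shows "f \<in> borel_measurable M" "integrable M (\<lambda>x. (f x)\<^sup>2)"
  using assms by (auto simp: sq_integrable_def)

lemma sq_integrable_mult:
  assumes "sq_integrable M f" "sq_integrable M g"
  shows "integrable M (\<lambda>x. f x * g x)"
proof (rule Bochner_Integration.integrable_bound)
  show "integrable M (\<lambda>x. (f x)\<^sup>2 + (g x)\<^sup>2)"
    using assms by (auto simp: sq_integrable_def)
  show "(\<lambda>x. f x * g x) \<in> borel_measurable M"
    using assms by (auto simp: sq_integrable_def)
  have "\<bar>a * b\<bar> \<le> a\<^sup>2 + b\<^sup>2" for a b :: real
  proof -
    have "0 \<le> (\<bar>a\<bar> - \<bar>b\<bar>)\<^sup>2" "0 \<le> \<bar>a\<bar> * \<bar>b\<bar>" by simp_all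
    then show ?thesis unfolding power2_diff abs_mult power2_abs by linarith
  qed
  then show "AE x in M. norm (f x * g x) \<le> norm ((f x)\<^sup>2 + (g x)\<^sup>2)"
    by simp
qed

lemma sq_integrable_cmult:
  "sq_integrable M f \<Longrightarrow> sq_integrable M (\<lambda>x. c * f x)"
  by (auto simp: sq_integrable_def power_mult_distrib)

lemma sq_integrable_add:
  assumes "sq_integrable M f" "sq_integrable M g"
  shows "sq_integrable M (\<lambda>x. f x + g x)"
  using assms sq_integrable_mult[OF assms]
  by (auto simp: sq_integrable_def power2_sum mult.assoc)

lemma sq_integrable_diff:
  assumes "sq_integrable M f" "sq_integrable M g"
  shows "sq_integrable M (\<lambda>x. f x - g x)"
  using sq_integrable_add[OF assms(1) sq_integrable_cmult[OF assms(2), of "-1"]] by simp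

lemma sq_integrable_sum:
  assumes "\<And>i. i \<in> F \<Longrightarrow> sq_integrable M (f i)"
  shows "sq_integrable M (\<lambda>x. \<Sum>i\<in>F. f i x)"
  using assms
proof (induction F rule: infinite_finite_induct)
  case (insert i F)
  then show ?case by (simp add: sq_integrable_add)
qed (auto simp: sq_integrable_def)

lemma integral_diff_scaled_square:
  assumes "sq_integrable M f" "sq_integrable M g"
  shows "(\<integral>x. (f x - t * g x)\<^sup>2 \<partial>M)
    = (\<integral>x. (f x)\<^sup>2 \<partial>M) - 2 * t * (\<integral>x. f x * g x \<partial>M) + t\<^sup>2 * (\<integral>x. (g x)\<^sup>2 \<partial>M)"
proof -
  note I = sq_integrable_mult[OF assms] sq_integrableD(2)[OF assms(1)] sq_integrableD(2)[OF assms(2)]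
  have "(\<integral>x. (f x - t * g x)\<^sup>2 \<partial>M)
      = (\<integral>x. (f x)\<^sup>2 - 2 * t * (f x * g x) + t\<^sup>2 * (g x)\<^sup>2 \<partial>M)"
    by (simp add: power2_eq_square algebra_simps)
  also have "\<dots> = (\<integral>x. (f x)\<^sup>2 \<partial>M) - 2 * t * (\<integral>x. f x * g x \<partial>M) + t\<^sup>2 * (\<integral>x. (g x)\<^sup>2 \<partial>M)"
    using I by simp
  finally show ?thesis .
qed

lemma integral_Cauchy_Schwarz:
  assumes "sq_integrable M f" "sq_integrable M g"
  shows "(\<integral>x. f x * g x \<partial>M)\<^sup>2 \<le> (\<integral>x. (f x)\<^sup>2 \<partial>M) * (\<integral>x. (g x)\<^sup>2 \<partial>M)"
proof -
  define A B C where "A = (\<integral>x. (f x)\<^sup>2 \<partial>M)" and "B = (\<integral>x. f x * g x \<partial>M)"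
    and "C = (\<integral>x. (g x)\<^sup>2 \<partial>M)"
  have quad: "0 \<le> A - 2 * t * B + t\<^sup>2 * C" for t
    using integral_diff_scaled_square[OF assms, of t]
      Bochner_Integration.integral_nonneg[of M "\<lambda>x. (f x - t * g x)\<^sup>2"]
    by (simp add: A_def B_def C_def)
  have "B\<^sup>2 \<le> A * C"
  proof (cases "C = 0")
    case True
    have "B = 0"
    proof (rule ccontr)
      assume "B \<noteq> 0"
      \<comment> \<open>At this t the linear term equals A + 1, so the quadratic would take the
        value -1.\<close>
      with quad[of "(A + 1) / (2 * B)"] True show False by simp
    qed
    then show ?thesis using True by simp
  next
    case False
    then have "0 < C" unfolding C_def by (simp add: order_less_le)
    \<comment> \<open>B / C minimises the quadratic, so nonnegativity there is the sharp
      inequality.\<close>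
    with quad[of "B / C"] have "0 \<le> A - B\<^sup>2 / C"
      by (simp add: power2_eq_square divide_simps split: if_splits)
    with \<open>0 < C\<close> show ?thesis by (simp add: field_simps)
  qed
  then show ?thesis by (simp add: A_def B_def C_def)
qed

text \<open>By Cauchy-Schwarz the error is at most the norm of \<open>f\<close> times the L^2
  distance from \<open>u F\<close> to \<open>h\<close>. The filter is arbitrary so that it can be
  \<open>finite_subsets_at_top\<close>.\<close>

lemma tendsto_integral_mult_L2:
  assumes f: "sq_integrable M f" and h: "sq_integrable M h" and u: "\<And>F. sq_integrable M (u F)"
    and lim: "((\<lambda>F. \<integral>x. (h x - u F x)\<^sup>2 \<partial>M) \<longlongrightarrow> 0) \<F>"
  shows "((\<lambda>F. \<integral>x. f x * u F x \<partial>M) \<longlongrightarrow> (\<integral>x. f x * h x \<partial>M)) \<F>"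
proof -
  have eq: "(\<integral>x. f x * (h x - u F x) \<partial>M) = (\<integral>x. f x * h x \<partial>M) - (\<integral>x. f x * u F x \<partial>M)" for F
    using sq_integrable_mult[OF f h] sq_integrable_mult[OF f u[of F]]
    by (simp add: right_diff_distrib)
  have "((\<lambda>F. (\<integral>x. f x * (h x - u F x) \<partial>M)\<^sup>2) \<longlongrightarrow> 0) \<F>"
  proof (rule tendsto_sandwich)
    show "\<forall>\<^sub>F F in \<F>. (0::real) \<le> (\<integral>x. f x * (h x - u F x) \<partial>M)\<^sup>2" by simp
    show "\<forall>\<^sub>F F in \<F>. (\<integral>x. f x * (h x - u F x) \<partial>M)\<^sup>2
        \<le> (\<integral>x. (f x)\<^sup>2 \<partial>M) * (\<integral>x. (h x - u F x)\<^sup>2 \<partial>M)"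
      by (intro always_eventually allI integral_Cauchy_Schwarz f sq_integrable_diff h u)
    show "((\<lambda>F. (\<integral>x. (f x)\<^sup>2 \<partial>M) * (\<integral>x. (h x - u F x)\<^sup>2 \<partial>M)) \<longlongrightarrow> 0) \<F>"
      using tendsto_mult_left[OF lim] by simp
  qed simp
  then have "((\<lambda>F. (\<integral>x. f x * h x \<partial>M) - (\<integral>x. f x * u F x \<partial>M)) \<longlongrightarrow> 0) \<F>"
    unfolding eq by (simp add: power_tendsto_0_iff)
  from tendsto_diff[OF tendsto_const this, of "\<integral>x. f x * h x \<partial>M"]
  show ?thesis by simp
qed

section \<open>Expansions in an orthonormal family: Bessel and Parseval\<close>

locale orthonormal_family = prob_space M for M :: "'a measure" +
  fixes e :: "'i \<Rightarrow> 'a \<Rightarrow> real"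
  assumes e_sq: "sq_integrable M (e p)"
    and orthonormal: "(\<integral>x. e p x * e q x \<partial>M) = (if p = q then 1 else 0)"
begin

definition coef :: "('a \<Rightarrow> real) \<Rightarrow> 'i \<Rightarrow> real" where
  "coef f p = (\<integral>x. f x * e p x \<partial>M)"

definition lincomb :: "('i \<Rightarrow> real) \<Rightarrow> 'i set \<Rightarrow> 'a \<Rightarrow> real" where
  "lincomb a F x = (\<Sum>p\<in>F. a p * e p x)"

lemma sq_integrable_lincomb: "sq_integrable M (lincomb a F)"
  unfolding lincomb_def by (intro sq_integrable_sum sq_integrable_cmult e_sq)

lemma integral_mult_lincomb:
  assumes "sq_integrable M f"
  shows "(\<integral>x. f x * lincomb a F x \<partial>M) = (\<Sum>p\<in>F. a p * coef f p)"
proof -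
  have "(\<integral>x. f x * lincomb a F x \<partial>M) = (\<integral>x. (\<Sum>p\<in>F. a p * (f x * e p x)) \<partial>M)"
    by (simp add: lincomb_def sum_distrib_left algebra_simps)
  also have "\<dots> = (\<Sum>p\<in>F. a p * coef f p)"
    unfolding coef_def by (subst Bochner_Integration.integral_sum) (auto intro!: sq_integrable_mult assms e_sq)
  finally show ?thesis .
qed

lemma coef_lincomb:
  assumes "finite F"
  shows "coef (lincomb a F) p = (if p \<in> F then a p else 0)"
proof -
  have "coef (lincomb a F) p = (\<integral>x. e p x * lincomb a F x \<partial>M)"
    by (simp add: coef_def mult.commute)
  also have "\<dots> = (\<Sum>q\<in>F. a q * (if p = q then 1 else 0))"
    by (simp add: integral_mult_lincomb[OF e_sq] coef_def orthonormal)
  finally show ?thesis using assms by (simp add: if_distrib cong: if_cong)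
qed

lemma integral_lincomb_square:
  assumes "finite F"
  shows "(\<integral>x. (lincomb a F x)\<^sup>2 \<partial>M) = (\<Sum>p\<in>F. (a p)\<^sup>2)"
  using integral_mult_lincomb[OF sq_integrable_lincomb, of a F a F] assms
  by (simp add: coef_lincomb power2_eq_square cong: sum.cong)

lemma integral_diff_lincomb_square:
  assumes "sq_integrable M f" "finite F"
  shows "(\<integral>x. (f x - lincomb a F x)\<^sup>2 \<partial>M)
    = (\<integral>x. (f x)\<^sup>2 \<partial>M) - 2 * (\<Sum>p\<in>F. a p * coef f p) + (\<Sum>p\<in>F. (a p)\<^sup>2)"
  using integral_diff_scaled_square[OF assms(1) sq_integrable_lincomb, of 1 a F]
  by (simp add: integral_mult_lincomb integral_lincomb_square assms)

lemma bessel_finite: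
  assumes "sq_integrable M f" "finite F"
  shows "(\<Sum>p\<in>F. (coef f p)\<^sup>2) \<le> (\<integral>x. (f x)\<^sup>2 \<partial>M)"
proof -
  have "0 \<le> (\<integral>x. (f x - lincomb (coef f) F x)\<^sup>2 \<partial>M)" by simp
  then show ?thesis
    unfolding integral_diff_lincomb_square[OF assms] by (simp add: power2_eq_square)
qed

lemma bessel:
  assumes "sq_integrable M f"
  shows "(\<lambda>p. (coef f p)\<^sup>2) summable_on A"
    and "(\<Sum>\<^sub>\<infinity>p\<in>A. (coef f p)\<^sup>2) \<le> (\<integral>x. (f x)\<^sup>2 \<partial>M)"
proof -
  show "(\<lambda>p. (coef f p)\<^sup>2) summable_on A"
    by (intro nonneg_bdd_above_summable_on bdd_aboveI2[where M = "\<integral>x. (f x)\<^sup>2 \<partial>M"])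
      (auto intro: bessel_finite[OF assms])
  then show "(\<Sum>\<^sub>\<infinity>p\<in>A. (coef f p)\<^sup>2) \<le> (\<integral>x. (f x)\<^sup>2 \<partial>M)"
    by (intro infsum_le_finite_sums bessel_finite assms)
qed

text \<open>The squared distance to a partial expansion is the squared norm minus a partial sum of
  squares, so equality in Bessel's inequality over \<open>A\<close> sends it to zero. It serves
  \<open>psi\<close> with all indices and an optimal estimator with \<open>A = MI S\<close>.\<close>

lemma lincomb_tendsto:
  assumes f: "sq_integrable M f" and "(\<Sum>\<^sub>\<infinity>p\<in>A. (coef f p)\<^sup>2) = (\<integral>x. (f x)\<^sup>2 \<partial>M)"
  shows "((\<lambda>F. \<integral>x. (f x - lincomb (coef f) F x)\<^sup>2 \<partial>M) \<longlongrightarrow> 0) (finite_subsets_at_top A)"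
proof -
  have "((\<lambda>F. \<Sum>p\<in>F. (coef f p)\<^sup>2) \<longlongrightarrow> (\<integral>x. (f x)\<^sup>2 \<partial>M)) (finite_subsets_at_top A)"
    using infsum_tendsto[OF bessel(1)[OF f, of A]] assms(2) by simp
  from tendsto_diff[OF tendsto_const this, of "\<integral>x. (f x)\<^sup>2 \<partial>M"]
  have "((\<lambda>F. (\<integral>x. (f x)\<^sup>2 \<partial>M) - (\<Sum>p\<in>F. (coef f p)\<^sup>2)) \<longlongrightarrow> 0) (finite_subsets_at_top A)"
    by simp
  moreover have "\<forall>\<^sub>F F in finite_subsets_at_top A.
      (\<integral>x. (f x)\<^sup>2 \<partial>M) - (\<Sum>p\<in>F. (coef f p)\<^sup>2) = (\<integral>x. (f x - lincomb (coef f) F x)\<^sup>2 \<partial>M)"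
    by (rule eventually_finite_subsets_at_top_weakI)
      (simp add: integral_diff_lincomb_square[OF f] flip: power2_eq_square)
  ultimately show ?thesis by (rule Lim_transform_eventually)
qed

text \<open>Only \<open>h\<close> has to be reproduced by its expansion; \<open>f\<close> may have a
  component orthogonal to the whole family.\<close>

lemma parseval:
  assumes f: "sq_integrable M f" and h: "sq_integrable M h"
    and "(\<Sum>\<^sub>\<infinity>p. (coef h p)\<^sup>2) = (\<integral>x. (h x)\<^sup>2 \<partial>M)"
  shows "((\<lambda>p. coef h p * coef f p) has_sum (\<integral>x. f x * h x \<partial>M)) UNIV"
  using tendsto_integral_mult_L2[OF f h sq_integrable_lincomb lincomb_tendsto[OF h assms(3)]]
  by (simp add: has_sum_def integral_mult_lincomb[OF f])

section \<open>The Riesz-Fischer theorem\<close>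

lemma integral_lincomb_diff_square_le:
  assumes "finite F" "finite H" "finite U" "F \<subseteq> U" "H \<subseteq> U" "K \<subseteq> F" "K \<subseteq> H"
  shows "(\<integral>x. (lincomb a F x - lincomb a H x)\<^sup>2 \<partial>M) \<le> (\<Sum>p\<in>U. (a p)\<^sup>2) - (\<Sum>p\<in>K. (a p)\<^sup>2)"
proof -
  \<comment> \<open>On \<open>K\<close> the coefficients cancel; elsewhere in \<open>U\<close> each
    difference is 0 or plus or minus \<open>a p\<close>. What remains is bounded by the sum of
    squares outside \<open>K\<close>.\<close>
  have "lincomb a F x - lincomb a H x
      = lincomb (\<lambda>p. (if p \<in> F then a p else 0) - (if p \<in> H then a p else 0)) U x" for x
    using assms unfolding lincomb_def left_diff_distrib sum_subtractf
    by (intro arg_cong2[where f = "(-)"] sum.mono_neutral_cong_left) auto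
  then have "(\<integral>x. (lincomb a F x - lincomb a H x)\<^sup>2 \<partial>M)
      = (\<Sum>p\<in>U. ((if p \<in> F then a p else 0) - (if p \<in> H then a p else 0))\<^sup>2)"
    by (simp add: integral_lincomb_square assms)
  also have "\<dots> \<le> (\<Sum>p\<in>U. (a p)\<^sup>2 - (if p \<in> K then (a p)\<^sup>2 else 0))"
    using assms by (intro sum_mono) (auto split: if_splits)
  also have "\<dots> = (\<Sum>p\<in>U. (a p)\<^sup>2) - (\<Sum>p\<in>K. (a p)\<^sup>2)"
    using assms unfolding sum_subtractf
    by (intro arg_cong2[where f = "(-)"] refl sum.mono_neutral_cong_right) auto
  finally show ?thesis .
qed

lemma integral_abs_le_L2:
  assumes "sq_integrable M f"
  shows "integrable M f" "(\<integral>x. \<bar>f x\<bar> \<partial>M)\<^sup>2 \<le> (\<integral>x. (f x)\<^sup>2 \<partial>M)"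
proof -
  have one: "sq_integrable M (\<lambda>x. 1)" by (simp add: sq_integrable_def)
  have abs: "sq_integrable M (\<lambda>x. \<bar>f x\<bar>)"
    using assms by (auto simp: sq_integrable_def)
  show "integrable M f" using sq_integrable_mult[OF assms one] by simp
  show "(\<integral>x. \<bar>f x\<bar> \<partial>M)\<^sup>2 \<le> (\<integral>x. (f x)\<^sup>2 \<partial>M)"
    using integral_Cauchy_Schwarz[OF abs one] by (simp add: prob_space)
qed

text \<open>A squared L^2 norm of at most 4^-k gives an L^1 norm of at most 2^-k for each increment,
  so the increments are absolutely summable almost everywhere and the sequence telescopes to a
  limit.\<close>

lemma riesz_fischer_limit:
  assumes fin: "\<And>k. finite (K k)"
    and small: "\<And>k m. k \<le> m \<Longrightarrow> (\<integral>x. (lincomb a (K m) x - lincomb a (K k) x)\<^sup>2 \<partial>M) \<le> (1/4) ^ k"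
  obtains f where "f \<in> borel_measurable M" "AE x in M. (\<lambda>k. lincomb a (K k) x) \<longlonglongrightarrow> f x"
proof -
  define s where "s k = lincomb a (K k)" for k
  have s: "sq_integrable M (s k)" for k
    unfolding s_def by (rule sq_integrable_lincomb)
  have [measurable]: "s k \<in> borel_measurable M" for k
    using s by (rule sq_integrableD)
  define d where "d k x = s (Suc k) x - s k x" for k x
  have d: "sq_integrable M (d k)" for k
    unfolding d_def by (intro sq_integrable_diff s)
  have [measurable]: "d k \<in> borel_measurable M" for k
    using d by (rule sq_integrableD)
  have "(\<integral>x. \<bar>d k x\<bar> \<partial>M) \<le> (1/2) ^ k" for k
  proof -
    have "(\<integral>x. \<bar>d k x\<bar> \<partial>M)\<^sup>2 \<le> (1/4) ^ k"
      using integral_abs_le_L2(2)[OF d[of k]] small[of k "Suc k"] by (simp add: d_def s_def)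
    also have "(1/4 :: real) ^ k = ((1/2) ^ k)\<^sup>2"
      by (simp add: power2_eq_square flip: power_mult_distrib)
    finally show ?thesis by (rule power2_le_imp_le) simp
  qed
  then have bound: "(\<integral>\<^sup>+x. ennreal \<bar>d k x\<bar> \<partial>M) \<le> ennreal ((1/2) ^ k)" for k
    using integral_abs_le_L2(1)[OF d[of k]]
    by (subst nn_integral_eq_integral) (auto intro!: ennreal_leI)
  have "(\<integral>\<^sup>+x. (\<Sum>k. ennreal \<bar>d k x\<bar>) \<partial>M) = (\<Sum>k. \<integral>\<^sup>+x. ennreal \<bar>d k x\<bar> \<partial>M)"
    by (rule nn_integral_suminf) measurable
  also have "\<dots> \<le> (\<Sum>k. ennreal ((1/2) ^ k))"
    by (intro suminf_le bound) auto
  also have "\<dots> = ennreal (\<Sum>k. (1/2) ^ k)"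
    by (intro suminf_ennreal2 summable_geometric) auto
  also have "\<dots> < \<infinity>" by simp
  finally have "(\<integral>\<^sup>+x. (\<Sum>k. ennreal \<bar>d k x\<bar>) \<partial>M) \<noteq> \<infinity>" by simp
  then have "AE x in M. (\<Sum>k. ennreal \<bar>d k x\<bar>) \<noteq> \<infinity>"
    by (intro nn_integral_PInf_AE) auto
  then have "AE x in M. (\<lambda>k. s k x) \<longlonglongrightarrow> lim (\<lambda>k. s k x)"
  proof eventually_elim
    case (elim x)
    then have "summable (\<lambda>k. \<bar>d k x\<bar>)"
      by (intro summable_suminf_not_top) auto
    then have "summable (\<lambda>k. d k x)" by (rule summable_rabs_cancel)
    then have "convergent (\<lambda>n. \<Sum>k<n. d k x)" by (simp add: summable_iff_convergent)
    then have "convergent (\<lambda>n. s n x - s 0 x)"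
      using sum_lessThan_telescope[of "\<lambda>n. s n x"] by (simp add: d_def)
    then obtain L where "(\<lambda>n. s n x - s 0 x) \<longlonglongrightarrow> L" by (auto simp: convergent_def)
    from tendsto_add[OF this tendsto_const[of "s 0 x"]]
    have "convergent (\<lambda>n. s n x)" by (auto simp: convergent_def)
    then show ?case by (rule convergent_LIMSEQ_iff[THEN iffD1])
  qed
  \<comment> \<open>Where the sequence diverges, \<open>lim\<close> still denotes some value; what
    matters is that the resulting function is measurable.\<close>
  moreover have "(\<lambda>x. lim (\<lambda>k. s k x)) \<in> borel_measurable M" by (rule borel_measurable_lim_metric) measurable
  ultimately show thesis using that unfolding s_def by blast
qed

text \<open>The net of finite partial sums is followed along a chain \<open>K k\<close> that
  captures the sum of squares up to 4^-k. The chain yields an almost-everywhere limit, and the error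
  bound for it extends to every finite set containing \<open>K k\<close>, hence to the whole
  net.\<close>

lemma riesz_fischer:
  assumes "(\<lambda>p. (a p)\<^sup>2) summable_on A"
  obtains f where "sq_integrable M f"
    "((\<lambda>F. \<integral>x. (f x - lincomb a F x)\<^sup>2 \<partial>M) \<longlongrightarrow> 0) (finite_subsets_at_top A)"
proof -
  define T where "T = (\<Sum>\<^sub>\<infinity>p\<in>A. (a p)\<^sup>2)"
  have T: "((\<lambda>F. \<Sum>p\<in>F. (a p)\<^sup>2) \<longlongrightarrow> T) (finite_subsets_at_top A)"
    unfolding T_def by (rule infsum_tendsto[OF assms])
  have T_ub: "(\<Sum>p\<in>F. (a p)\<^sup>2) \<le> T" if "finite F" "F \<subseteq> A" for F
    unfolding T_def using that assms by (intro finite_sum_le_infsum) auto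
  have "\<exists>G. finite G \<and> G \<subseteq> A \<and> T - (1/4)^k < (\<Sum>p\<in>G. (a p)\<^sup>2)" for k :: nat
  proof -
    have "\<forall>\<^sub>F F in finite_subsets_at_top A. T - (1/4)^k < (\<Sum>p\<in>F. (a p)\<^sup>2)"
      using T by (rule order_tendstoD) simp
    then show ?thesis by (auto simp: eventually_finite_subsets_at_top)
  qed
  then obtain G where G: "finite (G k)" "G k \<subseteq> A" "T - (1/4)^k < (\<Sum>p\<in>G k. (a p)\<^sup>2)" for k :: nat
    by metis
  \<comment> \<open>The sets \<open>G k\<close> come from a limit and need not be nested; their
    unions are, and they keep the lower bound.\<close>
  define K where "K k = (\<Union>j\<le>k. G j)" for k
  have K: "finite (K k)" "K k \<subseteq> A" for k
    using G by (auto simp: K_def)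
  have K_mono: "K k \<subseteq> K m" if "k \<le> m" for k m
    using that by (force simp: K_def)
  have K_lb: "T - (1/4)^k < (\<Sum>p\<in>K k. (a p)\<^sup>2)" for k
    by (rule less_le_trans[OF G(3)], rule sum_mono2[OF K(1)]) (auto simp: K_def)
  have near: "(\<integral>x. (lincomb a F x - lincomb a H x)\<^sup>2 \<partial>M) \<le> (1/4) ^ k"
    if "finite F" "finite H" "F \<subseteq> A" "H \<subseteq> A" "K k \<subseteq> F" "K k \<subseteq> H" for F H k
    using integral_lincomb_diff_square_le[of F H "F \<union> H" "K k" a] T_ub[of "F \<union> H"] K_lb[of k] that
    by auto
  obtain f where f: "f \<in> borel_measurable M"
      and conv: "AE x in M. (\<lambda>k. lincomb a (K k) x) \<longlonglongrightarrow> f x"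
    using riesz_fischer_limit[OF K(1) near[OF K(1) K(1) K(2) K(2) K_mono order_refl]] by blast
  have [measurable]: "lincomb a F \<in> borel_measurable M" for F
    using sq_integrable_lincomb by (rule sq_integrableD)
  note [measurable] = f
  \<comment> \<open>With \<open>F\<close> fixed, the combination over \<open>K m\<close> with m >= k
    is within squared distance 4^-k of the one over \<open>F\<close>; Fatou's lemma passes the bound
    to the limit \<open>f\<close>.\<close>
  have fatou: "(\<integral>\<^sup>+x. ennreal ((f x - lincomb a F x)\<^sup>2) \<partial>M) \<le> ennreal ((1/4) ^ k)"
    if F: "finite F" "F \<subseteq> A" "K k \<subseteq> F" for F k
  proof -
    let ?u = "\<lambda>m x. ennreal ((lincomb a (K m) x - lincomb a F x)\<^sup>2)"
    have "AE x in M. ennreal ((f x - lincomb a F x)\<^sup>2) = liminf (\<lambda>m. ?u m x)"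
      using conv
    proof eventually_elim
      case (elim x)
      then have "(\<lambda>m. ?u m x) \<longlonglongrightarrow> ennreal ((f x - lincomb a F x)\<^sup>2)"
        by (intro tendsto_ennrealI tendsto_intros)
      then show ?case by (intro lim_imp_Liminf[symmetric]) auto
    qed
    then have "(\<integral>\<^sup>+x. ennreal ((f x - lincomb a F x)\<^sup>2) \<partial>M) = (\<integral>\<^sup>+x. liminf (\<lambda>m. ?u m x) \<partial>M)"
      by (rule nn_integral_cong_AE)
    also have "\<dots> \<le> liminf (\<lambda>m. \<integral>\<^sup>+x. ?u m x \<partial>M)"
      by (rule nn_integral_liminf) measurable
    also have "\<dots> \<le> liminf (\<lambda>m. ennreal ((1/4) ^ k))"
    proof (rule Liminf_mono)
      have "(\<integral>\<^sup>+x. ?u m x \<partial>M) \<le> ennreal ((1/4) ^ k)" if "k \<le> m" for m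
        using near[OF K(1)[of m] F(1) K(2) F(2) K_mono[OF that] F(3)]
          sq_integrableD(2)[OF sq_integrable_diff[OF sq_integrable_lincomb sq_integrable_lincomb], of a "K m" a F]
        by (subst nn_integral_eq_integral) (auto intro: ennreal_leI)
      then show "\<forall>\<^sub>F m in sequentially. (\<integral>\<^sup>+x. ?u m x \<partial>M) \<le> ennreal ((1/4) ^ k)"
        by (auto simp: eventually_sequentially)
    qed
    also have "\<dots> = ennreal ((1/4) ^ k)" by (simp add: Liminf_const)
    finally show ?thesis .
  qed
  have near_f: "sq_integrable M (\<lambda>x. f x - lincomb a F x)"
      "(\<integral>x. (f x - lincomb a F x)\<^sup>2 \<partial>M) \<le> (1/4) ^ k"
    if F: "finite F" "F \<subseteq> A" "K k \<subseteq> F" for F k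
  proof -
    have "integrable M (\<lambda>x. (f x - lincomb a F x)\<^sup>2)"
      using fatou[OF that] by (intro integrableI_bounded) (auto simp: le_less_trans)
    then show "sq_integrable M (\<lambda>x. f x - lincomb a F x)"
      by (simp add: sq_integrable_def)
    then show "(\<integral>x. (f x - lincomb a F x)\<^sup>2 \<partial>M) \<le> (1/4) ^ k"
      using fatou[OF that] by (subst (asm) nn_integral_eq_integral) (auto simp: sq_integrable_def)
  qed
  \<comment> \<open>\<open>f\<close> is its error relative to \<open>lincomb a (K 0)\<close> plus
    that combination.\<close>
  have "sq_integrable M f"
    using sq_integrable_add[OF near_f(1)[OF K(1,2) order_refl] sq_integrable_lincomb, of 0 a "K 0"]
    by simp
  moreover have "((\<lambda>F. \<integral>x. (f x - lincomb a F x)\<^sup>2 \<partial>M) \<longlongrightarrow> 0) (finite_subsets_at_top A)"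
  proof (rule tendstoI)
    fix \<epsilon> :: real assume "0 < \<epsilon>"
    then obtain k where k: "(1/4) ^ k < \<epsilon>"
      using real_arch_pow_inv[of \<epsilon> "1/4"] by auto
    show "\<forall>\<^sub>F F in finite_subsets_at_top A. dist (\<integral>x. (f x - lincomb a F x)\<^sup>2 \<partial>M) 0 < \<epsilon>"
      unfolding eventually_finite_subsets_at_top
      using K[of k] near_f(2) k by (intro exI[of _ "K k"]) (auto intro: le_less_trans)
  qed
  ultimately show thesis by (rule that)
qed

text \<open>Testing against \<open>e p\<close> preserves the limit, and the coefficient of a partial
  sum is constant as soon as the index set contains \<open>p\<close>; for \<open>p\<close> outside
  \<open>A\<close> it is always 0.\<close>

lemma coef_eq_of_tendsto:
  assumes f: "sq_integrable M f"
    and lim: "((\<lambda>F. \<integral>x. (f x - lincomb a F x)\<^sup>2 \<partial>M) \<longlongrightarrow> 0) (finite_subsets_at_top A)"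
  shows "coef f p = (if p \<in> A then a p else 0)"
proof -
  have "((\<lambda>F. \<integral>x. e p x * lincomb a F x \<partial>M) \<longlongrightarrow> (\<integral>x. e p x * f x \<partial>M)) (finite_subsets_at_top A)"
    by (rule tendsto_integral_mult_L2[OF e_sq f sq_integrable_lincomb lim])
  then have "((\<lambda>F. coef (lincomb a F) p) \<longlongrightarrow> coef f p) (finite_subsets_at_top A)"
    by (simp add: coef_def mult.commute)
  moreover have "\<forall>\<^sub>F F in finite_subsets_at_top A. coef (lincomb a F) p = (if p \<in> A then a p else 0)"
  proof (cases "p \<in> A")
    case True
    then show ?thesis unfolding eventually_finite_subsets_at_top
      by (intro exI[of _ "{p}"]) (auto simp: coef_lincomb)
  next
    case False
    then show ?thesis
      by (intro eventually_finite_subsets_at_top_weakI) (auto simp: coef_lincomb)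
  qed
  ultimately show ?thesis
    using tendsto_unique[OF finite_subsets_at_top_neq_bot _ tendsto_eventually] by blast
qed

text \<open>The inner products of \<open>f\<close> with the partial sums tend to its squared norm,
  and the coefficients of \<open>f\<close> on \<open>A\<close> are already known to be
  \<open>a\<close>.\<close>

lemma norm_eq_of_tendsto:
  assumes f: "sq_integrable M f"
    and lim: "((\<lambda>F. \<integral>x. (f x - lincomb a F x)\<^sup>2 \<partial>M) \<longlongrightarrow> 0) (finite_subsets_at_top A)"
  shows "(\<integral>x. (f x)\<^sup>2 \<partial>M) = (\<Sum>\<^sub>\<infinity>p\<in>A. (a p)\<^sup>2)"
proof -
  have "((\<lambda>F. \<integral>x. f x * lincomb a F x \<partial>M) \<longlongrightarrow> (\<integral>x. f x * f x \<partial>M)) (finite_subsets_at_top A)"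
    by (rule tendsto_integral_mult_L2[OF f f sq_integrable_lincomb lim])
  then have "((\<lambda>p. a p * coef f p) has_sum (\<integral>x. (f x)\<^sup>2 \<partial>M)) A"
    by (simp add: integral_mult_lincomb[OF f] has_sum_def power2_eq_square)
  then have "((\<lambda>p. (a p)\<^sup>2) has_sum (\<integral>x. (f x)\<^sup>2 \<partial>M)) A"
    by (subst (asm) has_sum_cong[where g = "\<lambda>p. (a p)\<^sup>2"])
      (auto simp: coef_eq_of_tendsto[OF assms] power2_eq_square)
  then show ?thesis by (simp add: infsumI)
qed

end

section \<open>Hermite polynomials and one-dimensional Gaussian integrals\<close>

text \<open>The probabilists' Hermite polynomials, generated by the raising operator X - d/dX that
  suits the standard normal weight.\<close>

primrec hermite :: "nat \<Rightarrow> real poly" where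
  "hermite 0 = 1"
| "hermite (Suc n) = pCons 0 (hermite n) - pderiv (hermite n)"

text \<open>Commuting d/dX with X - d/dX adds one copy of the Hermite polynomial at each induction
  step, which accumulates the factor.\<close>

lemma pderiv_hermite_Suc: "pderiv (hermite (Suc n)) = smult (of_nat (Suc n)) (hermite n)"
proof (induction n)
  case (Suc n)
  have "pderiv (hermite (Suc (Suc n)))
      = hermite (Suc n) + pCons 0 (pderiv (hermite (Suc n))) - pderiv (pderiv (hermite (Suc n)))"
    by (simp add: pderiv_diff pderiv_pCons)
  also have "\<dots> = hermite (Suc n) + smult (of_nat (Suc n)) (pCons 0 (hermite n) - pderiv (hermite n))"
    by (simp add: Suc.IH pderiv_smult smult_diff_right del: hermite.simps of_nat_Suc)
  also have "\<dots> = hermite (Suc n) + smult (of_nat (Suc n)) (hermite (Suc n))" by simp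
  also have "\<dots> = smult (of_nat (Suc (Suc n))) (hermite (Suc n))"
    by (simp only: of_nat_Suc[of "Suc n"] smult_add_left smult_1_left)
  finally show ?case .
qed (simp add: pderiv_diff pderiv_pCons one_pCons)

section \<open>Gaussian moments, Stein's identity and orthogonality\<close>

lemma integrable_std_normal_poly: "integrable lborel (\<lambda>t. std_normal_density t * poly q t)"
  unfolding poly_altdef sum_distrib_left
proof (intro Bochner_Integration.integrable_sum)
  fix i
  show "integrable lborel (\<lambda>t. std_normal_density t * (coeff q i * t ^ i))"
    using integrable_mult_right[OF integrable_std_normal_moment[of i], of "coeff q i"]
    by (simp add: mult.left_commute)
qed

text \<open>Integration by parts for monomials, read off from the closed forms of the even and odd
  moments. At n = 0 the truncated exponent \<open>n - 1\<close> is harmless because the factor n is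
  0.\<close>

lemma std_normal_moment_Suc:
  "(\<integral>t. std_normal_density t * t ^ Suc n \<partial>lborel)
    = of_nat n * (\<integral>t. std_normal_density t * t ^ (n - 1) \<partial>lborel)"
proof (cases "even n")
  case True
  then obtain k where n: "n = 2 * k" by blast
  show ?thesis
  proof (cases k)
    case 0
    then show ?thesis using integral_std_normal_moment_odd[of 0] n by simp
  next
    case (Suc j)
    then show ?thesis
      using integral_std_normal_moment_odd[of k] integral_std_normal_moment_odd[of j] n by simp
  qed
next
  case False
  then obtain k where n: "n = 2 * k + 1" by (metis oddE)
  have *: "Suc n = 2 * Suc k" "n - 1 = 2 * k" using n by simp_all
  have fact2: "(fact (2 * Suc k) :: real) = 2 * (real k + 1) * (2 * real k + 1) * fact (2 * k)"
    by (simp add: algebra_simps)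
  \<comment> \<open>Factorials and powers become variables, so that the cancellation is a pure field
    identity.\<close>
  have cancel: "(2 * (b + 1) * (2 * b + 1) * F) / (2 * P * ((b + 1) * Q)) = (2 * b + 1) * (F / (P * Q))"
    if "b + 1 \<noteq> 0" for b F P Q :: real
    using that by (simp add: divide_simps)
  have fact1: "(fact (Suc k) :: real) = (real k + 1) * fact k" and real_n: "real n = 2 * real k + 1"
    using n by simp_all
  show ?thesis
    unfolding * integral_std_normal_moment_even power_Suc fact2 fact1 real_n by (rule cancel) simp
qed

text \<open>Stein's identity: the recursion for moments extends from monomials to polynomials by
  linearity.\<close>

lemma std_normal_stein:
  "(\<integral>t. std_normal_density t * poly (pCons 0 q) t \<partial>lborel)
    = (\<integral>t. std_normal_density t * poly (pderiv q) t \<partial>lborel)"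
proof -
  have int: "integrable lborel (\<lambda>t. std_normal_density t * (c * t ^ k))" for c k
    using integrable_mult_right[OF integrable_std_normal_moment[of k], of c]
    by (simp add: mult.left_commute)
  have [simp]: "(\<integral>t. std_normal_density t * (c * t ^ k) \<partial>lborel)
      = c * (\<integral>t. std_normal_density t * t ^ k \<partial>lborel)" for c k
    by (simp add: mult.left_commute flip: integral_mult_right_zero)
  define a where "a = coeff q"
  define d where "d = degree q"
  have "poly (pCons 0 q) t = (\<Sum>i\<le>d. a i * t ^ Suc i)" for t
    by (simp add: poly_altdef[of q] a_def d_def sum_distrib_left mult_ac)
  \<comment> \<open>Uniqueness of the derivative turns \<open>pderiv\<close> into a sum indexed like
    that of \<open>q\<close>, without a shift of coefficients.\<close>
  moreover have "poly (pderiv q) t = (\<Sum>i\<le>d. (a i * of_nat i) * t ^ (i - 1))" for t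
  proof -
    have "(\<Sum>i\<le>d. a i * t ^ i) = poly q t" for t
      by (simp add: poly_altdef[of q] a_def d_def)
    then have eq: "poly q = (\<lambda>t. \<Sum>i\<le>d. a i * t ^ i)" by auto
    have "((\<lambda>t. \<Sum>i\<le>d. a i * t ^ i) has_field_derivative (\<Sum>i\<le>d. (a i * of_nat i) * t ^ (i - 1))) (at t)"
      by (auto intro!: derivative_eq_intros sum.cong)
    then show ?thesis
      unfolding eq[symmetric] using DERIV_unique poly_DERIV by blast
  qed
  ultimately show ?thesis
    using int by (simp add: sum_distrib_left std_normal_moment_Suc del: power_Suc) (simp add: mult.assoc)
qed

text \<open>Under the Gaussian weight, d/dX is adjoint to X - d/dX: Stein's identity cancels the
  first two terms of the expansion and leaves the derivative on \<open>q\<close>.\<close>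

lemma std_normal_hermite_mult:
  "(\<integral>t. std_normal_density t * poly (hermite (Suc n) * q) t \<partial>lborel)
    = (\<integral>t. std_normal_density t * poly (hermite n * pderiv q) t \<partial>lborel)"
proof -
  have *: "std_normal_density t * poly (hermite (Suc n) * q) t
      = std_normal_density t * poly (pCons 0 (hermite n * q)) t
        - std_normal_density t * poly (pderiv (hermite n * q)) t
        + std_normal_density t * poly (hermite n * pderiv q) t" for t
    by (simp add: pderiv_mult algebra_simps)
  show ?thesis
    unfolding * using std_normal_stein[of "hermite n * q"]
    by (simp add: integrable_std_normal_poly del: poly_mult poly_pCons)
qed

text \<open>Moving a raising operator across lowers both indices by one and yields the factor of
  \<open>pderiv_hermite_Suc\<close>; these factors build the factorial. If one index reaches 0
  first, a constant gets differentiated.\<close>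

lemma hermite_orthogonal:
  "(\<integral>t. std_normal_density t * poly (hermite m * hermite n) t \<partial>lborel) = (if m = n then fact n else 0)"
proof (induction m arbitrary: n)
  case 0
  show ?case
  proof (cases n)
    case 0
    then show ?thesis by simp
  next
    case (Suc k)
    have "(\<integral>t. std_normal_density t * poly (hermite 0 * hermite n) t \<partial>lborel)
        = (\<integral>t. std_normal_density t * poly (hermite (Suc k) * 1) t \<partial>lborel)"
      by (simp add: Suc)
    also have "\<dots> = 0" unfolding std_normal_hermite_mult by simp
    finally show ?thesis using Suc by simp
  qed
next
  case (Suc m)
  show ?case
  proof (cases n)
    case 0
    then show ?thesis unfolding std_normal_hermite_mult by simp
  next
    case (Suc k)
    have *: "std_normal_density t * poly (hermite m * smult (real (Suc k)) (hermite k)) t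
        = real (Suc k) * (std_normal_density t * poly (hermite m * hermite k) t)" for t
      by simp
    show ?thesis
      unfolding std_normal_hermite_mult Suc pderiv_hermite_Suc * integral_mult_right_zero Suc.IH
      by simp
  qed
qed

text \<open>After the shift the recursion consists of the two sides of Stein's identity, which
  cancel, and one factor x.\<close>

lemma hermite_shifted_mean:
  "(\<integral>t. std_normal_density t * poly (pcompose (hermite n) [:x, 1:]) t \<partial>lborel) = x ^ n"
proof (induction n)
  case (Suc n)
  let ?r = "pcompose (hermite n) [:x, 1:]"
  have *: "std_normal_density t * poly (pcompose (hermite (Suc n)) [:x, 1:]) t
      = std_normal_density t * poly (pCons 0 ?r) t
        - std_normal_density t * poly (pderiv ?r) t
        + x * (std_normal_density t * poly ?r t)" for t
    by (simp add: pderiv_pcompose pcompose_diff pcompose_pCons poly_pcompose pderiv_pCons algebra_simps)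
  show ?case
    unfolding * using std_normal_stein[of ?r] Suc.IH
    by (simp add: integrable_std_normal_poly del: poly_pCons)
qed (simp add: pcompose_1)

section \<open>Exponential tilts and affine changes of the normal density\<close>

lemma std_normal_tilt: "std_normal_density t * exp (x * t - x\<^sup>2 / 2) = std_normal_density (t - x)"
  by (simp add: std_normal_density_def exp_add[symmetric] power2_eq_square field_simps)

text \<open>The exponential tilts the normal density into its translate by x, which reduces the
  integral to \<open>hermite_shifted_mean\<close>. The value is the inner product of the generating
  function with the n-th Hermite polynomial.\<close>

lemma std_normal_exp_hermite:
  "has_bochner_integral lborel
    (\<lambda>t. std_normal_density t * (exp (x * t - x\<^sup>2 / 2) * poly (hermite n) t)) (x ^ n)"
proof -
  have "has_bochner_integral lborel
      (\<lambda>t. std_normal_density t * poly (pcompose (hermite n) [:x, 1:]) t) (x ^ n)"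
    using hermite_shifted_mean integrable_std_normal_poly by (simp add: has_bochner_integral_iff)
  then have "has_bochner_integral lborel
      (\<lambda>t. std_normal_density (t - x) * poly (hermite n) t) (x ^ n)"
    using lborel_has_bochner_integral_real_affine_iff[of 1
        "\<lambda>t. std_normal_density (t - x) * poly (hermite n) t" "x ^ n" x]
    by (simp add: poly_pcompose add.commute)
  then show ?thesis
    by (simp add: std_normal_tilt flip: mult.assoc)
qed

lemma std_normal_exp_square:
  "has_bochner_integral lborel
    (\<lambda>t. std_normal_density t * (exp (x * t - x\<^sup>2 / 2))\<^sup>2) (exp (x\<^sup>2))"
proof -
  \<comment> \<open>Completing the square: 2xt - x^2 = x^2 + (2x)t - (2x)^2/2, the case n = 0 at
    parameter 2x.\<close>
  have *: "std_normal_density t * (exp (x * t - x\<^sup>2 / 2))\<^sup>2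
      = exp (x\<^sup>2) * (std_normal_density t * (exp ((2*x) * t - (2*x)\<^sup>2 / 2) * poly (hermite 0) t))" for t
    by (simp add: power2_eq_square exp_add[symmetric] mult_ac)
  show ?thesis
    unfolding * using has_bochner_integral_mult_right[OF std_normal_exp_hermite[of "2*x" 0], of "exp (x\<^sup>2)"] by simp
qed

text \<open>Since -(t - m)^2 - 4tm = -(t + m)^2, the weight reflects the mean from m to -m; the
  substitution t = \<sigma> v - m then standardises the variable.\<close>

lemma normal_density_reflected_mean:
  assumes "\<sigma> > 0" and "has_bochner_integral lborel (\<lambda>v. std_normal_density v * G v) c"
  shows "has_bochner_integral lborel
    (\<lambda>t. normal_density m \<sigma> t * (exp (- (2 * t * m / \<sigma>\<^sup>2)) * G ((t + m) / \<sigma>))) c"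
proof -
  have "normal_density m \<sigma> (\<sigma> * v - m) * exp (- (2 * (\<sigma> * v - m) * m / \<sigma>\<^sup>2))
      = std_normal_density v / \<sigma>" for v
  proof -
    have "- ((\<sigma> * v - m - m)\<^sup>2 / (2 * \<sigma>\<^sup>2)) - 2 * (\<sigma> * v - m) * m / \<sigma>\<^sup>2 = - (v\<^sup>2 / 2)"
      using assms(1) by (simp add: field_simps power2_eq_square)
    then have "exp (- ((\<sigma> * v - m - m)\<^sup>2 / (2 * \<sigma>\<^sup>2))) * exp (- (2 * (\<sigma> * v - m) * m / \<sigma>\<^sup>2)) = exp (- (v\<^sup>2 / 2))"
      by (simp add: exp_add[symmetric])
    then show ?thesis
      using assms(1) by (simp add: normal_density_def std_normal_density_def real_sqrt_mult field_simps)
  qed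
  then have *: "normal_density m \<sigma> (\<sigma> * v - m) * (exp (- (2 * (\<sigma> * v - m) * m / \<sigma>\<^sup>2)) * z)
      = std_normal_density v * z / \<sigma>" for v z
    by (simp flip: mult.assoc)
  have "has_bochner_integral lborel (\<lambda>v. std_normal_density v * G v / \<sigma>) (c / \<sigma>)"
    using assms(2) by (intro has_bochner_integral_divide_zero)
  moreover have "(\<lambda>v. normal_density m \<sigma> (- m + \<sigma> * v)
        * (exp (- (2 * (- m + \<sigma> * v) * m / \<sigma>\<^sup>2)) * G ((- m + \<sigma> * v + m) / \<sigma>)))
      = (\<lambda>v. std_normal_density v * G v / \<sigma>)"
  proof
    fix v
    have "- m + \<sigma> * v = \<sigma> * v - m" "(\<sigma> * v - m + m) / \<sigma> = v"
      using assms(1) by simp_all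
    then show "normal_density m \<sigma> (- m + \<sigma> * v)
        * (exp (- (2 * (- m + \<sigma> * v) * m / \<sigma>\<^sup>2)) * G ((- m + \<sigma> * v + m) / \<sigma>))
      = std_normal_density v * G v / \<sigma>"
      by (simp only: *)
  qed
  moreover have "c /\<^sub>R \<bar>\<sigma>\<bar> = c / \<sigma>"
    using assms(1) by (simp add: divide_inverse mult.commute)
  ultimately show ?thesis
    using assms(1) lborel_has_bochner_integral_real_affine_iff[of \<sigma>
        "\<lambda>t. normal_density m \<sigma> t * (exp (- (2 * t * m / \<sigma>\<^sup>2)) * G ((t + m) / \<sigma>))" c "- m"]
    by simp
qed

section \<open>Power series in several variables\<close>

lemma has_sum_diff_real:
  fixes f g :: "'i \<Rightarrow> real"
  assumes "(f has_sum a) A" "(g has_sum b) A"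
  shows "((\<lambda>x. f x - g x) has_sum (a - b)) A"
  using has_sum_add[OF assms(1) has_sum_uminusI[OF assms(2)]] by simp

lemma exp_has_sum: "((\<lambda>n. s ^ n / fact n) has_sum exp s) UNIV" for s :: real
  using summable_norm_exp[of s] exp_converges[of s]
  by (intro norm_summable_imp_has_sum) (simp_all add: divide_inverse mult.commute)

lemma exp_multi_index_has_sum:
  fixes s :: "'n::finite \<Rightarrow> real"
  assumes "\<And>i. s i \<ge> 0"
  shows "((\<lambda>q. \<Prod>i\<in>UNIV. s i ^ q i / fact (q i)) has_sum exp (\<Sum>i\<in>UNIV. s i)) UNIV"
proof -
  let ?f = "\<lambda>q. \<Prod>i\<in>UNIV. s i ^ q i / fact (q i)"
  have "infsum ?f (PiE UNIV (\<lambda>_. UNIV)) = (\<Prod>i\<in>UNIV. \<Sum>\<^sub>\<infinity>n. s i ^ n / fact n)"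
    using assms
    by (intro infsum_prod_PiE_abs) (auto intro: has_sum_imp_summable exp_has_sum)
  then have eq: "infsum ?f UNIV = exp (\<Sum>i\<in>UNIV. s i)"
    by (simp add: infsumI[OF exp_has_sum] exp_sum PiE_UNIV_domain)
  then have "?f summable_on UNIV" \<comment> \<open>nonsummable terms have sum $0$, but the sum is positive\<close>
    using infsum_not_exists[of ?f UNIV] by fastforce
  then show ?thesis
    unfolding eq[symmetric] by (rule has_sum_infsum)
qed

text \<open>Convergence at all radii, weighted by total degree alone: the condition survives
  differentiation and dominates the series on every bounded set.\<close>

definition entire_coeffs :: "(('n::finite \<Rightarrow> nat) \<Rightarrow> real) \<Rightarrow> bool" where
  "entire_coeffs b \<longleftrightarrow> (\<forall>R\<ge>0. (\<lambda>q. \<bar>b q\<bar> * R ^ (\<Sum>i\<in>UNIV. q i)) summable_on UNIV)"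

definition multi_series :: "(('n::finite \<Rightarrow> nat) \<Rightarrow> real) \<Rightarrow> real^'n \<Rightarrow> real" where
  "multi_series b x = (\<Sum>\<^sub>\<infinity>q. b q * mpow x q)"

definition diff_coeffs :: "'n \<Rightarrow> (('n::finite \<Rightarrow> nat) \<Rightarrow> real) \<Rightarrow> ('n \<Rightarrow> nat) \<Rightarrow> real" where
  "diff_coeffs i b q = real (Suc (q i)) * b (q(i := Suc (q i)))"

section \<open>Termwise differentiation\<close>

lemma sum_fun_upd_Suc: "(\<Sum>j\<in>UNIV. (q(i := Suc (q i))) j) = Suc (\<Sum>j\<in>UNIV. q j)"
  for q :: "'n::finite \<Rightarrow> nat"
  by (simp add: sum.remove[of UNIV i])

lemma inj_fun_upd_Suc: "inj (\<lambda>q. q(i := Suc (q i)))"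
proof (rule injI)
  fix q r :: "'a \<Rightarrow> nat" assume "q(i := Suc (q i)) = r(i := Suc (r i))"
  then have "(q(i := Suc (q i))) j = (r(i := Suc (r i))) j" for j by simp
  then have "q j = r j" for j by (cases "j = i") (metis fun_upd_same nat.inject, metis fun_upd_other)
  then show "q = r" by (rule ext)
qed

lemma range_fun_upd_Suc: "range (\<lambda>q. q(i := Suc (q i))) = {q. q i \<noteq> 0}"
proof (intro equalityI subsetI)
  fix q :: "'a \<Rightarrow> nat" assume "q \<in> {q. q i \<noteq> 0}"
  then show "q \<in> range (\<lambda>q. q(i := Suc (q i)))"
    by (intro image_eqI[where x = "q(i := q i - 1)"]) auto
qed auto

lemma entire_diff_coeffs:
  fixes b :: "('n::finite \<Rightarrow> nat) \<Rightarrow> real"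
  assumes "entire_coeffs b"
  shows "entire_coeffs (diff_coeffs i b)"
  unfolding entire_coeffs_def
proof (intro allI impI)
  fix R :: real assume R: "0 \<le> R"
  let ?up = "\<lambda>q::'n \<Rightarrow> nat. q(i := Suc (q i))"
  \<comment> \<open>With d the total degree, the 2 absorbs \<open>Suc (q i)\<close> <= 2^(d+1), and
    the added 1 makes R^d at most (R+1)^(d+1).\<close>
  let ?g = "\<lambda>q. \<bar>b q\<bar> * (2 * (R + 1)) ^ (\<Sum>j\<in>UNIV. q j)"
  have "?g summable_on UNIV"
    using assms R unfolding entire_coeffs_def by simp
  then have "?g summable_on range ?up"
    by (rule summable_on_subset_banach) simp
  then have sum: "(?g \<circ> ?up) summable_on UNIV"
    using summable_on_reindex[OF inj_fun_upd_Suc[of i], of ?g] by simp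
  have "\<bar>diff_coeffs i b q\<bar> * R ^ (\<Sum>j\<in>UNIV. q j) \<le> (?g \<circ> ?up) q" for q
  proof -
    define d where "d = (\<Sum>j\<in>UNIV. q j)"
    have "q i \<le> d" unfolding d_def by (rule member_le_sum) auto
    then have "Suc (q i) \<le> 2 ^ Suc d"
      using less_exp[of "Suc d"] by linarith
    then have "real (Suc (q i)) \<le> 2 ^ Suc d"
      by (metis of_nat_le_iff of_nat_numeral of_nat_power)
    moreover have "R ^ d \<le> (R + 1) ^ Suc d"
      using R power_mono[of R "R + 1" d] power_increasing[of d "Suc d" "R + 1"] by linarith
    ultimately have "real (Suc (q i)) * R ^ d \<le> 2 ^ Suc d * (R + 1) ^ Suc d"
      using R by (intro mult_mono) auto
    then have "real (Suc (q i)) * R ^ d * \<bar>b (?up q)\<bar> \<le> (2 * (R + 1)) ^ Suc d * \<bar>b (?up q)\<bar>"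
      unfolding power_mult_distrib by (rule mult_right_mono) simp
    then show ?thesis
      unfolding comp_def sum_fun_upd_Suc d_def[symmetric] diff_coeffs_def abs_mult
      by (simp only: abs_of_nat mult_ac)
  qed
  then show "(\<lambda>q. \<bar>diff_coeffs i b q\<bar> * R ^ (\<Sum>j\<in>UNIV. q j)) summable_on UNIV"
    using R by (intro summable_on_comparison_test[OF sum]) auto
qed

text \<open>A Taylor remainder whose dependence on n is geometric, so that it can be summed against
  \<open>entire_coeffs\<close>. In the induction the factor s + t is at most |s| + 1 and the extra
  term contributes one more, which explains |s| + 2.\<close>

lemma power_second_order_bound:
  fixes s t :: real
  assumes "\<bar>t\<bar> \<le> 1"
  shows "\<bar>(s + t) ^ n - s ^ n - t * (real n * s ^ (n - 1))\<bar> \<le> t\<^sup>2 * (\<bar>s\<bar> + 2) ^ n"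
proof (induction n)
  case (Suc n)
  have bern: "real n * \<bar>s\<bar> ^ (n - 1) \<le> (\<bar>s\<bar> + 2) ^ n"
  proof (cases n)
    case (Suc m)
    have "real (Suc j) * r ^ j \<le> (r + 2) ^ Suc j" if "0 \<le> r" for r :: real and j
    proof (induction j)
      case (Suc j)
      have "real (Suc (Suc j)) * r ^ Suc j = r * (real (Suc j) * r ^ j) + r ^ Suc j"
        by (simp add: algebra_simps)
      also have "\<dots> \<le> r * (r + 2) ^ Suc j + (r + 2) ^ Suc j"
        using that Suc.IH by (intro add_mono mult_left_mono power_mono) auto
      also have "\<dots> \<le> (r + 2) ^ Suc (Suc j)"
        using that by (simp add: algebra_simps)
      finally show ?case .
    qed (use that in simp)
    then show ?thesis using Suc by simp
  qed simp
  have split: "(s + t) ^ Suc n - s ^ Suc n - t * (real (Suc n) * s ^ (Suc n - 1))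
      = (s + t) * ((s + t) ^ n - s ^ n - t * (real n * s ^ (n - 1))) + t\<^sup>2 * (real n * s ^ (n - 1))"
    by (cases n) (simp_all add: algebra_simps power2_eq_square)
  have "\<bar>(s + t) * ((s + t) ^ n - s ^ n - t * (real n * s ^ (n - 1)))\<bar>
      \<le> (\<bar>s\<bar> + 1) * (t\<^sup>2 * (\<bar>s\<bar> + 2) ^ n)"
    unfolding abs_mult using assms Suc.IH by (intro mult_mono) auto
  moreover have "\<bar>t\<^sup>2 * (real n * s ^ (n - 1))\<bar> \<le> t\<^sup>2 * (\<bar>s\<bar> + 2) ^ n"
    using bern by (simp add: abs_mult power_abs mult_left_mono)
  ultimately have "\<bar>(s + t) ^ Suc n - s ^ Suc n - t * (real (Suc n) * s ^ (Suc n - 1))\<bar>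
      \<le> (\<bar>s\<bar> + 1) * (t\<^sup>2 * (\<bar>s\<bar> + 2) ^ n) + t\<^sup>2 * (\<bar>s\<bar> + 2) ^ n"
    unfolding split by linarith
  also have "\<dots> = t\<^sup>2 * (\<bar>s\<bar> + 2) ^ Suc n"
    by (simp add: algebra_simps)
  finally show ?case .
qed simp

lemma has_field_derivative_quadratic_bound:
  fixes f :: "real \<Rightarrow> real"
  assumes "\<And>t. \<bar>t\<bar> \<le> 1 \<Longrightarrow> \<bar>f t - f 0 - t * L\<bar> \<le> t\<^sup>2 * K"
  shows "(f has_field_derivative L) (at 0)"
proof -
  have "((\<lambda>t. (f t - f 0) / t - L) \<longlongrightarrow> 0) (at 0)"
  proof (rule Lim_null_comparison)
    show "\<forall>\<^sub>F t in at 0. norm ((f t - f 0) / t - L) \<le> \<bar>t\<bar> * K"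
      unfolding eventually_at
    proof (intro exI[of _ 1] conjI ballI impI)
      fix t :: real assume t: "t \<noteq> 0 \<and> dist t 0 < 1"
      then have "\<bar>f t - f 0 - t * L\<bar> \<le> \<bar>t\<bar> * (\<bar>t\<bar> * K)"
        using assms[of t] by (simp add: power2_eq_square abs_mult[symmetric] flip: mult.assoc)
      moreover have "(f t - f 0) / t - L = (f t - f 0 - t * L) / t"
        using t by (simp add: field_simps)
      ultimately show "norm ((f t - f 0) / t - L) \<le> \<bar>t\<bar> * K"
        using t by (simp add: divide_simps mult.commute)
    qed simp
    show "((\<lambda>t. \<bar>t\<bar> * K) \<longlongrightarrow> 0) (at (0::real))"
      by (auto intro!: tendsto_eq_intros)
  qed
  then have "((\<lambda>t. (f t - f 0) / t) \<longlongrightarrow> L) (at 0)"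
    by (rule LIM_zero_cancel)
  then show ?thesis
    by (simp add: DERIV_def)
qed

text \<open>The remainders of all terms together are at most t^2 times one convergent series, so the
  sum is differentiable at t = 0 with the termwise derivative.\<close>

lemma partial_multi_series:
  fixes b :: "('n::finite \<Rightarrow> nat) \<Rightarrow> real"
  assumes b: "entire_coeffs b"
  shows "partial i (multi_series b) = multi_series (diff_coeffs i b)"
proof
  fix x :: "real^'n"
  define s where "s = x $ i"
  \<comment> \<open>The 2 makes room for the |s| + 2 of the remainder bound and also covers |s + t|
    when |t| <= 1.\<close>
  define R where "R = norm x + 2"
  have R: "1 \<le> R" "\<bar>x $ j\<bar> + 2 \<le> R" for j
    using component_le_norm_cart[of x j] by (auto simp: R_def)
  have R_ge: "\<bar>x $ j\<bar> \<le> R" for j using R(2)[of j] by linarith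
  define rest where "rest q = (\<Prod>j\<in>UNIV - {i}. (x $ j) ^ q j)" for q :: "'n \<Rightarrow> nat"
  define val where "val t q = b q * ((s + t) ^ q i * rest q)" for t q
  define der where "der q = b q * (real (q i) * s ^ (q i - 1) * rest q)" for q
  define maj where "maj q = \<bar>b q\<bar> * R ^ (\<Sum>i\<in>UNIV. q i)" for q
  have maj: "maj summable_on UNIV"
    using b R(1) unfolding maj_def entire_coeffs_def by auto
  have rest_le: "\<bar>b q * (c * rest q)\<bar> \<le> K * maj q" if "\<bar>c\<bar> \<le> K * R ^ q i" for q c K
  proof -
    have "\<bar>rest q\<bar> \<le> (\<Prod>j\<in>UNIV - {i}. R ^ q j)"
      unfolding rest_def abs_prod power_abs
      using R_ge by (intro prod_mono conjI power_mono) auto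
    then have "\<bar>c\<bar> * \<bar>rest q\<bar> \<le> (K * R ^ q i) * (\<Prod>j\<in>UNIV - {i}. R ^ q j)"
      using that by (intro mult_mono) auto
    also have "\<dots> = K * R ^ (\<Sum>i\<in>UNIV. q i)"
      by (simp add: power_sum prod.remove[of UNIV i])
    finally have "\<bar>b q\<bar> * (\<bar>c\<bar> * \<bar>rest q\<bar>) \<le> \<bar>b q\<bar> * (K * R ^ (\<Sum>i\<in>UNIV. q i))"
      by (rule mult_left_mono) simp
    then show ?thesis
      unfolding maj_def abs_mult by (simp only: mult.left_commute[of K])
  qed
  have mpow_eq: "mpow (x + t *\<^sub>R axis i 1) q = (s + t) ^ q i * rest q" for t q
    unfolding mpow_def rest_def s_def
    by (subst prod.remove[of UNIV i]) (auto simp: axis_def intro!: prod.cong)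
  have pow_le: "\<bar>(s + t) ^ n\<bar> \<le> 1 * R ^ n" if "\<bar>t\<bar> \<le> 1" for t n
    unfolding power_abs using that R(2)[of i] by (simp add: s_def power_mono)
  have val: "val t summable_on UNIV" if "\<bar>t\<bar> \<le> 1" for t
  proof (rule abs_summable_summable, rule summable_on_comparison_test[OF maj])
    fix q
    have "\<bar>b q * ((s + t) ^ q i * rest q)\<bar> \<le> 1 * maj q"
      by (rule rest_le, rule pow_le, rule that)
    then show "norm (val t q) \<le> maj q"
      unfolding val_def real_norm_def by (simp only: mult_1)
  qed simp
  have series_eq: "multi_series b (x + t *\<^sub>R axis i 1) = (\<Sum>\<^sub>\<infinity>q. val t q)" for t
    unfolding multi_series_def val_def mpow_eq ..
  have diff_le: "\<bar>val t q - val 0 q - t * der q\<bar> \<le> t\<^sup>2 * maj q" if "\<bar>t\<bar> \<le> 1" for t q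
  proof -
    have "val t q - val 0 q - t * der q
        = b q * (((s + t) ^ q i - s ^ q i - t * (real (q i) * s ^ (q i - 1))) * rest q)"
      by (simp add: val_def der_def algebra_simps)
    moreover have "(\<bar>s\<bar> + 2) ^ q i \<le> R ^ q i"
      using R(2)[of i] by (intro power_mono) (auto simp: s_def)
    then have "t\<^sup>2 * (\<bar>s\<bar> + 2) ^ q i \<le> t\<^sup>2 * R ^ q i"
      by (rule mult_left_mono) simp
    with power_second_order_bound[OF that, of s "q i"]
    have "\<bar>(s + t) ^ q i - s ^ q i - t * (real (q i) * s ^ (q i - 1))\<bar> \<le> t\<^sup>2 * R ^ q i"
      by (rule order_trans)
    then show ?thesis unfolding calculation by (rule rest_le)
  qed
  \<comment> \<open>At t = 1 the remainder is dominated by \<open>maj\<close>; subtracting it from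
    the difference of two convergent series shows that \<open>der\<close> is summable.\<close>
  have "(\<lambda>q. val 1 q - val 0 q - 1 * der q) summable_on UNIV"
  proof (rule abs_summable_summable, rule summable_on_comparison_test[OF maj])
    fix q
    show "norm (val 1 q - val 0 q - 1 * der q) \<le> maj q"
      using diff_le[of 1 q] by simp
  qed simp
  from has_sum_diff_real[OF has_sum_diff_real[OF has_sum_infsum[OF val[of 1]]
    has_sum_infsum[OF val[of 0]]] has_sum_infsum[OF this]]
  have "der summable_on UNIV" by (auto intro: has_sum_imp_summable)
  then have der: "(der has_sum (\<Sum>\<^sub>\<infinity>q. der q)) UNIV" by (rule has_sum_infsum)
  have "((\<lambda>t. \<Sum>\<^sub>\<infinity>q. val t q) has_field_derivative (\<Sum>\<^sub>\<infinity>q. der q)) (at 0)"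
  proof (rule has_field_derivative_quadratic_bound)
    fix t :: real assume t: "\<bar>t\<bar> \<le> 1"
    have "((\<lambda>q. val t q - val 0 q - t * der q) has_sum
        (\<Sum>\<^sub>\<infinity>q. val t q) - (\<Sum>\<^sub>\<infinity>q. val 0 q) - t * (\<Sum>\<^sub>\<infinity>q. der q)) UNIV"
      using val[OF t] val[of 0] by (intro has_sum_diff_real has_sum_cmult_right has_sum_infsum der) auto
    from norm_infsum_le[OF this has_sum_cmult_right[OF has_sum_infsum[OF maj], of "t\<^sup>2"]] diff_le[OF t]
    show "\<bar>(\<Sum>\<^sub>\<infinity>q. val t q) - (\<Sum>\<^sub>\<infinity>q. val 0 q) - t * (\<Sum>\<^sub>\<infinity>q. der q)\<bar>
        \<le> t\<^sup>2 * (\<Sum>\<^sub>\<infinity>q. maj q)" by simp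
  qed
  moreover have term_eq: "der (q(i := Suc (q i))) = diff_coeffs i b q * mpow x q" for q
  proof -
    have "rest (q(i := Suc (q i))) = rest q"
      unfolding rest_def by (intro prod.cong) auto
    moreover have "mpow x q = s ^ q i * rest q" using mpow_eq[of 0 q] by simp
    ultimately show ?thesis by (simp add: der_def diff_coeffs_def mult_ac)
  qed
  ultimately have "partial i (multi_series b) x = (\<Sum>\<^sub>\<infinity>q. der q)"
    unfolding partial_def series_eq by (intro DERIV_imp_deriv)
  \<comment> \<open>Terms with \<open>q i = 0\<close> vanish through the factor
    \<open>real (q i)\<close>; the others are exactly the shifted indices.\<close>
  also have "\<dots> = (\<Sum>\<^sub>\<infinity>q\<in>range (\<lambda>q. q(i := Suc (q i))). der q)"
    unfolding range_fun_upd_Suc by (rule infsum_cong_neutral) (auto simp: der_def)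
  also have "\<dots> = (\<Sum>\<^sub>\<infinity>q. der (q(i := Suc (q i))))"
    by (subst infsum_reindex[OF inj_fun_upd_Suc]) (simp add: comp_def)
  finally show "partial i (multi_series b) x = multi_series (diff_coeffs i b) x"
    by (simp only: multi_series_def term_eq)
qed

section \<open>Mixed derivatives at the origin\<close>

lemma foldr_partial_multi_series:
  assumes "entire_coeffs b"
  shows "entire_coeffs (foldr diff_coeffs l b)"
    and "foldr partial l (multi_series b) = multi_series (foldr diff_coeffs l b)"
  by (induction l) (simp_all add: assms entire_diff_coeffs partial_multi_series)

text \<open>Multiplication by q! avoids quotients of factorials; at q = 0 the identity becomes
  Taylor's coefficient formula.\<close>

lemma foldr_diff_coeffs:
  "foldr diff_coeffs l b q * mfact q
    = b (\<lambda>i. q i + count_list l i) * mfact (\<lambda>i. q i + count_list l i)"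
proof (induction l arbitrary: q)
  case (Cons j l)
  have mfact_Suc: "mfact (q(j := Suc (q j))) = real (Suc (q j)) * mfact q"
  proof -
    have "(\<Prod>i\<in>UNIV - {j}. fact ((q(j := Suc (q j))) i) :: real) = (\<Prod>i\<in>UNIV - {j}. fact (q i))"
      by (intro prod.cong) auto
    then show ?thesis
      unfolding mfact_def by (simp add: prod.remove[of UNIV j])
  qed
  have "(\<lambda>i. (q(j := Suc (q j))) i + count_list l i) = (\<lambda>i. q i + count_list (j # l) i)"
    by auto
  moreover have "foldr diff_coeffs (j # l) b q * mfact q
      = foldr diff_coeffs l b (q(j := Suc (q j))) * mfact (q(j := Suc (q j)))"
    unfolding foldr.simps comp_def diff_coeffs_def[of j "foldr diff_coeffs l b"] mfact_Suc
    by (simp only: mult_ac)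
  ultimately show ?case
    using Cons.IH[of "q(j := Suc (q j))"] by (simp only:)
qed simp

lemma multi_series_zero:
  fixes b :: "('n::finite \<Rightarrow> nat) \<Rightarrow> real"
  shows "multi_series b 0 = b (\<lambda>_. 0)"
proof -
  have "mpow 0 q = (if q = (\<lambda>_. 0) then 1 else 0)" for q :: "'n \<Rightarrow> nat"
    by (auto simp: mpow_def fun_eq_iff prod_zero_iff)
  then have "multi_series b 0 = (\<Sum>\<^sub>\<infinity>q\<in>{\<lambda>_. 0}. b q)"
    unfolding multi_series_def by (intro infsum_cong_neutral) auto
  then show ?thesis by simp
qed

text \<open>\<open>dirs\<close> is a choice, so a list with these multiplicities must be exhibited;
  finiteness of the index type makes \<open>p\<close> the count function of a multiset.\<close>

lemma count_list_dirs: "count_list (dirs p) i = p i"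
proof -
  have "finite {i. 0 < p i}" by simp
  then obtain M where M: "count M = p"
    using count_Abs_multiset[of p] by blast
  obtain l where "mset l = M" using ex_mset by blast
  then have "\<forall>i. count_list l i = p i"
    using M by (metis count_mset)
  then show ?thesis
    unfolding dirs_def by (rule someI2) blast
qed

lemma mpartial_multi_series:
  assumes "entire_coeffs b"
  shows "mpartial p (multi_series b) 0 = mfact p * b p"
proof -
  have "mpartial p (multi_series b) 0 = foldr diff_coeffs (dirs p) b (\<lambda>_. 0)"
    by (simp add: mpartial_def foldr_partial_multi_series assms multi_series_zero)
  also have "\<dots> = mfact p * b p"
    using foldr_diff_coeffs[of "dirs p" b "\<lambda>_. 0"] by (simp add: count_list_dirs mfact_def mult.commute)
  finally show ?thesis .
qed

text \<open>A derivative at a point supported in \<open>T\<close>, in a direction from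
  \<open>T\<close>, evaluates its argument only at points supported in \<open>T\<close>. Agreement
  there suffices although this set need not be open.\<close>

lemma foldr_partial_cong:
  assumes "\<And>x. {i. x $ i \<noteq> 0} \<subseteq> T \<Longrightarrow> f x = h x" "set l \<subseteq> T" "{i. x $ i \<noteq> 0} \<subseteq> T"
  shows "foldr partial l f x = foldr partial l h x"
  using assms(2,3)
proof (induction l arbitrary: x)
  case (Cons j l)
  have "foldr partial l f (x + t *\<^sub>R axis j 1) = foldr partial l h (x + t *\<^sub>R axis j 1)" for t
    using Cons.prems by (intro Cons.IH) (auto simp: axis_def)
  then show ?case
    by (simp add: partial_def[of j "foldr partial l f"] partial_def[of j "foldr partial l h"])
qed (use assms(1) in simp)

lemma mpartial_cong:
  assumes "\<And>x. {i. x $ i \<noteq> 0} \<subseteq> {i. p i \<noteq> 0} \<Longrightarrow> f x = h x"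
  shows "mpartial p f 0 = mpartial p h 0"
  unfolding mpartial_def
proof (rule foldr_partial_cong[where T = "{i. p i \<noteq> 0}"])
  show "set (dirs p) \<subseteq> {i. p i \<noteq> 0}"
    using count_list_0_iff[of "dirs p"] by (simp add: subset_eq count_list_dirs)
qed (use assms in auto)

text \<open>\<open>D i\<close> is a tower of successive derivatives; a mixed derivative of a product
  of one-variable functions selects a level in each coordinate, whatever the order of
  \<open>l\<close>.\<close>

lemma foldr_partial_prod:
  fixes D :: "'n::finite \<Rightarrow> nat \<Rightarrow> real \<Rightarrow> real"
  assumes D: "\<And>i n s. (D i n has_field_derivative D i (Suc n) s) (at s)"
  shows "foldr partial l (\<lambda>x. C * (\<Prod>i\<in>UNIV. D i 0 (x $ i)))
    = (\<lambda>x. C * (\<Prod>i\<in>UNIV. D i (count_list l i) (x $ i)))"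
proof (induction l)
  case (Cons j l)
  show ?case
  proof
    fix x :: "real^'n"
    define k where "k = count_list l"
    define A where "A = C * (\<Prod>i\<in>UNIV - {j}. D i (k i) (x $ i))"
    have "C * (\<Prod>i\<in>UNIV. D i (k i) ((x + t *\<^sub>R axis j 1) $ i)) = A * D j (k j) (x $ j + t)" for t
    proof -
      have "(\<Prod>i\<in>UNIV - {j}. D i (k i) ((x + t *\<^sub>R axis j 1) $ i)) = (\<Prod>i\<in>UNIV - {j}. D i (k i) (x $ i))"
        by (intro prod.cong) (auto simp: axis_def)
      then show ?thesis by (simp add: prod.remove[of UNIV j] A_def)
    qed
    moreover have "((\<lambda>t. A * D j (k j) (x $ j + t)) has_field_derivative A * D j (Suc (k j)) (x $ j)) (at 0)"
      using D[of j "k j" "x $ j"] DERIV_shift[of "D j (k j)" "D j (Suc (k j)) (x $ j)" 0 "x $ j"]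
      by (intro DERIV_cmult) (simp add: add.commute)
    moreover have "A * D j (Suc (k j)) (x $ j) = C * (\<Prod>i\<in>UNIV. D i (count_list (j # l) i) (x $ i))"
    proof -
      have "(\<Prod>i\<in>UNIV - {j}. D i (count_list (j # l) i) (x $ i)) = (\<Prod>i\<in>UNIV - {j}. D i (k i) (x $ i))"
        by (intro prod.cong) (auto simp: k_def)
      then show ?thesis by (simp add: prod.remove[of UNIV j] A_def k_def)
    qed
    ultimately show "foldr partial (j # l) (\<lambda>x. C * (\<Prod>i\<in>UNIV. D i 0 (x $ i))) x
        = C * (\<Prod>i\<in>UNIV. D i (count_list (j # l) i) (x $ i))"
      unfolding foldr.simps comp_def Cons.IH partial_def[of j] k_def[symmetric]
      by (simp add: DERIV_imp_deriv)
  qed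
qed simp

lemma mfact_pos: "0 < mfact p"
  unfolding mfact_def by (intro prod_pos) auto

lemma entire_coeffs_of_l2:
  fixes a :: "('n::finite \<Rightarrow> nat) \<Rightarrow> real"
  assumes "(\<lambda>p. (a p)\<^sup>2) summable_on A"
  shows "entire_coeffs (\<lambda>q. if q \<in> A then a q / sqrt (mfact q) else 0)"
  unfolding entire_coeffs_def
proof (intro allI impI)
  fix R :: real assume R: "0 \<le> R"
  let ?E = "\<lambda>q::'n \<Rightarrow> nat. \<Prod>i\<in>UNIV. (R\<^sup>2) ^ q i / fact (q i)"
  have E: "?E summable_on UNIV"
    using exp_multi_index_has_sum[of "\<lambda>_. R\<^sup>2"] by (auto intro: has_sum_imp_summable)
  then have "?E summable_on A"
    by (rule summable_on_subset_banach) simp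
  then have "(\<lambda>q. (a q)\<^sup>2 + ?E q) summable_on A"
    by (intro summable_on_add assms)
  then have "(\<lambda>q. \<bar>a q / sqrt (mfact q)\<bar> * R ^ (\<Sum>i\<in>UNIV. q i)) summable_on A"
  proof (rule summable_on_comparison_test)
    fix q :: "'n \<Rightarrow> nat"
    note pos = mfact_pos[of q]
    \<comment> \<open>The squares of these weights are the terms of the multi-index exponential
      series, so |a| r <= a^2 + r^2 is a summable bound.\<close>
    define r where "r = R ^ (\<Sum>i\<in>UNIV. q i) / sqrt (mfact q)"
    have "r\<^sup>2 = ?E q"
      using pos by (simp add: r_def power_divide mfact_def power_sum prod_dividef prod_power_distrib flip: power_mult)
        (simp add: mult.commute)
    moreover have "0 \<le> r" using R pos by (simp add: r_def)
    moreover have "0 \<le> (\<bar>a q\<bar> - r)\<^sup>2" "0 \<le> \<bar>a q\<bar> * r" using \<open>0 \<le> r\<close> by simp_all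
    then have "\<bar>a q\<bar> * r \<le> (a q)\<^sup>2 + r\<^sup>2" unfolding power2_diff power2_abs by linarith
    ultimately show "\<bar>a q / sqrt (mfact q)\<bar> * R ^ (\<Sum>i\<in>UNIV. q i) \<le> (a q)\<^sup>2 + ?E q"
      using pos by (simp add: r_def abs_divide)
  qed (use R in simp)
  then show "(\<lambda>q. \<bar>if q \<in> A then a q / sqrt (mfact q) else 0\<bar> * R ^ (\<Sum>i\<in>UNIV. q i)) summable_on UNIV"
    by (rule summable_on_cong_neutral[THEN iffD1, rotated -1]) auto
qed

section \<open>Hermite functions for the observation model\<close>

lemma has_bochner_integral_lborel_prod:
  fixes f :: "'a::euclidean_space \<Rightarrow> real \<Rightarrow> real"
  assumes "\<And>b. b \<in> Basis \<Longrightarrow> has_bochner_integral lborel (f b) (c b)"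
  shows "has_bochner_integral lborel (\<lambda>x. \<Prod>b\<in>Basis. f b (x \<bullet> b)) (\<Prod>b\<in>Basis. c b)"
proof -
  interpret product_sigma_finite "\<lambda>_::'a. lborel :: real measure" ..
  have int: "integrable lborel (f b)" "integral\<^sup>L lborel (f b) = c b" if "b \<in> Basis" for b
    using assms[OF that] by (auto simp: has_bochner_integral_iff)
  have [measurable]: "f b \<in> borel_measurable borel" if "b \<in> Basis" for b
    using int(1)[OF that] borel_measurable_integrable by fastforce
  have coord: "(\<Sum>b'\<in>Basis. w b' *\<^sub>R b') \<bullet> b = w b" if "b \<in> Basis" for w and b :: 'a
    using that by simp
  have "has_bochner_integral (\<Pi>\<^sub>M b\<in>Basis. lborel) (\<lambda>w. \<Prod>b\<in>Basis. f b (w b)) (\<Prod>b\<in>Basis. c b)"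
    using product_integrable_prod[of Basis f] product_integral_prod[of Basis f] int
    by (simp add: has_bochner_integral_iff)
  then have "has_bochner_integral (distr (\<Pi>\<^sub>M b\<in>Basis. lborel) borel (\<lambda>w. \<Sum>b\<in>Basis. w b *\<^sub>R b))
      (\<lambda>x. \<Prod>b\<in>Basis. f b (x \<bullet> b)) (\<Prod>b\<in>Basis. c b)"
    by (intro has_bochner_integral_distr) (simp_all add: coord cong: prod.cong)
  then show ?thesis by (simp flip: lborel_eq)
qed

lemma prod_Basis_vec: "(\<Prod>b\<in>Basis. h b) = (\<Prod>i\<in>UNIV. h (axis i (1::real) :: real^'n))"
proof -
  have Basis: "Basis = range (\<lambda>i. axis i (1::real) :: real^'n)"
    by (auto simp: Basis_vec_def)
  have inj: "inj (\<lambda>i. axis i (1::real) :: real^'n)"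
    by (auto simp: inj_on_def axis_eq_axis)
  show ?thesis unfolding Basis prod.reindex[OF inj] comp_def ..
qed

lemma has_bochner_integral_lborel_prod_vec:
  fixes f :: "'n::finite \<Rightarrow> real \<Rightarrow> real"
  assumes "\<And>i. has_bochner_integral lborel (f i) (c i)"
  shows "has_bochner_integral lborel (\<lambda>x::real^'n. \<Prod>i\<in>UNIV. f i (x $ i)) (\<Prod>i\<in>UNIV. c i)"
  using has_bochner_integral_lborel_prod[of "\<lambda>b::real^'n. f (axis_index b)" "\<lambda>b. c (axis_index b)"] assms
  by (simp add: prod_Basis_vec inner_axis)

section \<open>The Gaussian law of the observation\<close>

lemma gauss_pdf_eq_prod:
  assumes "\<sigma> > 0"
  shows "gauss_pdf \<sigma> x y = (\<Prod>i\<in>UNIV. normal_density (x $ i) \<sigma> (y $ i))"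
proof -
  have "(norm (y - x))\<^sup>2 = (\<Sum>i\<in>UNIV. (y $ i - x $ i)\<^sup>2)"
    unfolding power2_norm_eq_inner by (simp add: inner_vec_def power2_eq_square)
  then have "exp (- (norm (y - x))\<^sup>2 / (2 * \<sigma>\<^sup>2)) = (\<Prod>i\<in>UNIV. exp (- (y $ i - x $ i)\<^sup>2 / (2 * \<sigma>\<^sup>2)))"
    by (simp add: exp_sum[symmetric] sum_divide_distrib sum_negf)
  then show ?thesis
    by (simp add: gauss_pdf_def normal_density_def prod.distrib prod_dividef power_one_over)
qed

lemma gauss_pdf_nonneg: "0 \<le> gauss_pdf \<sigma> x y"
  by (simp add: gauss_pdf_def)

lemma borel_measurable_gauss_pdf [measurable]: "gauss_pdf \<sigma> x \<in> borel_measurable borel"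
  unfolding gauss_pdf_def by measurable

lemma sets_obs [measurable_cong]: "sets (obs \<sigma> x) = sets borel"
  by (simp add: obs_def)

lemma space_obs [simp]: "space (obs \<sigma> x) = UNIV"
  by (simp add: obs_def)

lemma borel_measurable_obs [simp]: "borel_measurable (obs \<sigma> x) = borel_measurable borel"
  by (rule measurable_cong_sets) (simp_all add: sets_obs)

lemma has_bochner_integral_obs:
  assumes "f \<in> borel_measurable borel"
  shows "has_bochner_integral (obs \<sigma> x) f c \<longleftrightarrow> has_bochner_integral lborel (\<lambda>y. gauss_pdf \<sigma> x y * f y) c"
  using assms unfolding obs_def
  by (simp add: has_bochner_integral_iff integrable_density integral_density gauss_pdf_nonneg)

lemma has_bochner_integral_obs_prod:
  fixes x :: "real^'n"
  assumes "\<sigma> > 0" and [measurable]: "\<And>i. F i \<in> borel_measurable borel"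
    and "\<And>i. has_bochner_integral lborel (\<lambda>t. normal_density (x $ i) \<sigma> t * F i t) (c i)"
  shows "has_bochner_integral (obs \<sigma> x) (\<lambda>y. \<Prod>i\<in>UNIV. F i (y $ i)) (\<Prod>i\<in>UNIV. c i)"
proof -
  have "(\<lambda>y::real^'n. y $ i) \<in> borel_measurable borel" for i
    by (intro borel_measurable_continuous_onI continuous_intros)
  note [measurable] = this
  show ?thesis
    using has_bochner_integral_lborel_prod_vec[OF assms(3)]
    by (subst has_bochner_integral_obs) (simp_all add: gauss_pdf_eq_prod[OF assms(1)] prod.distrib)
qed

lemma prob_space_obs:
  assumes "\<sigma> > 0"
  shows "prob_space (obs \<sigma> x)"
proof -
  have "has_bochner_integral lborel (\<lambda>y. gauss_pdf \<sigma> x y) (\<Prod>i\<in>(UNIV::'a set). 1)"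
    unfolding gauss_pdf_eq_prod[OF assms]
    by (rule has_bochner_integral_lborel_prod_vec)
      (simp add: has_bochner_integral_iff integrable_normal_density[OF assms] integral_normal_density[OF assms])
  then have "(\<integral>\<^sup>+y. ennreal (gauss_pdf \<sigma> x y) \<partial>lborel) = 1"
    by (subst nn_integral_eq_integral) (auto simp: has_bochner_integral_iff gauss_pdf_nonneg)
  then show ?thesis
    by (intro prob_spaceI) (simp add: obs_def emeasure_density)
qed

text \<open>The Hermite polynomials in $(y + x_0)/\sigma$ are orthogonal for the Gaussian with mean $-x_0$;
  the factor $e^{-\langle y, x_0\rangle/\sigma^2}$ moves the mean to $x_0$.\<close>

definition hermite_obs :: "real \<Rightarrow> real^'n \<Rightarrow> ('n::finite \<Rightarrow> nat) \<Rightarrow> real^'n \<Rightarrow> real" where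
  "hermite_obs \<sigma> x0 p y = exp (- (y \<bullet> x0) / \<sigma>\<^sup>2) *
     (\<Prod>i\<in>UNIV. poly (hermite (p i)) ((y $ i + x0 $ i) / \<sigma>))"

lemma psi_eq_prod:
  assumes "\<sigma> > 0"
  shows "psi \<sigma> x0 x y = exp (- (y \<bullet> x0) / \<sigma>\<^sup>2) *
    (\<Prod>i\<in>UNIV. exp (x $ i * ((y $ i + x0 $ i) / \<sigma>) - (x $ i)\<^sup>2 / 2))"
proof -
  have "(y \<bullet> (\<sigma> *\<^sub>R x - x0)) / \<sigma>\<^sup>2 + (x0 \<bullet> x) / \<sigma> - (norm x)\<^sup>2 / 2
      = - (y \<bullet> x0) / \<sigma>\<^sup>2 + (y \<bullet> x / \<sigma> + (x0 \<bullet> x) / \<sigma> - (x \<bullet> x) / 2)"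
    unfolding power2_norm_eq_inner using assms
    by (simp add: inner_diff_right field_simps power2_eq_square)
  also have "y \<bullet> x / \<sigma> + (x0 \<bullet> x) / \<sigma> - (x \<bullet> x) / 2
      = (\<Sum>i\<in>UNIV. x $ i * ((y $ i + x0 $ i) / \<sigma>) - (x $ i)\<^sup>2 / 2)"
    by (simp add: inner_vec_def sum_divide_distrib power2_eq_square add_divide_distrib distrib_left
      mult.commute sum.distrib sum_subtractf)
  finally show ?thesis
    unfolding psi_def by (simp only: exp_add exp_sum finite)
qed

text \<open>Both factors of an inner product carry the exponential weight, hence its square. It
  reflects the mean in every coordinate and reduces the integral to standard normal ones.\<close>

lemma has_bochner_integral_obs_weighted_prod:
  fixes x0 :: "real^'n"
  assumes \<sigma>: "\<sigma> > 0" and G: "\<And>i. G i \<in> borel_measurable borel"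
    and int: "\<And>i. has_bochner_integral lborel (\<lambda>v. std_normal_density v * G i v) (c i)"
  shows "has_bochner_integral (obs \<sigma> x0)
    (\<lambda>y. (exp (- (y \<bullet> x0) / \<sigma>\<^sup>2))\<^sup>2 * (\<Prod>i\<in>UNIV. G i ((y $ i + x0 $ i) / \<sigma>))) (\<Prod>i\<in>UNIV. c i)"
proof -
  have "(exp (- (y \<bullet> x0) / \<sigma>\<^sup>2))\<^sup>2 = (\<Prod>i\<in>UNIV. exp (- (2 * (y $ i) * x0 $ i / \<sigma>\<^sup>2)))" for y :: "real^'n"
  proof -
    have "2 * (- (y \<bullet> x0) / \<sigma>\<^sup>2) = (\<Sum>i\<in>UNIV. - (2 * (y $ i) * x0 $ i / \<sigma>\<^sup>2))"
      by (simp add: inner_vec_def sum_negf sum_divide_distrib sum_distrib_left mult.assoc)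
    then show ?thesis by (simp only: exp_double[symmetric] exp_sum finite)
  qed
  moreover note [measurable] = G
  have "has_bochner_integral (obs \<sigma> x0)
      (\<lambda>y. \<Prod>i\<in>UNIV. exp (- (2 * (y $ i) * x0 $ i / \<sigma>\<^sup>2)) * G i ((y $ i + x0 $ i) / \<sigma>)) (\<Prod>i\<in>UNIV. c i)"
    by (rule has_bochner_integral_obs_prod[OF \<sigma>])
      (measurable, intro normal_density_reflected_mean \<sigma> int)
  ultimately show ?thesis by (simp add: prod.distrib)
qed

lemma borel_measurable_poly [measurable]: "poly q \<in> borel_measurable borel" for q :: "real poly"
  by (intro borel_measurable_continuous_onI continuous_intros)

lemma has_bochner_integral_hermite_obs:
  assumes "\<sigma> > 0"
  shows "has_bochner_integral (obs \<sigma> x0) (\<lambda>y. hermite_obs \<sigma> x0 p y * hermite_obs \<sigma> x0 q y)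
    (if p = q then mfact p else 0)"
proof -
  have "has_bochner_integral lborel
      (\<lambda>v. std_normal_density v * poly (hermite (p i) * hermite (q i)) v) (if p i = q i then fact (q i) else 0)" for i
    using hermite_orthogonal[of "p i" "q i"] integrable_std_normal_poly[of "hermite (p i) * hermite (q i)"]
    by (simp add: has_bochner_integral_iff)
  from has_bochner_integral_obs_weighted_prod[OF assms _ this]
  have "has_bochner_integral (obs \<sigma> x0) (\<lambda>y. (exp (- (y \<bullet> x0) / \<sigma>\<^sup>2))\<^sup>2 *
      (\<Prod>i\<in>UNIV. poly (hermite (p i) * hermite (q i)) ((y $ i + x0 $ i) / \<sigma>)))
      (\<Prod>i\<in>UNIV. if p i = q i then fact (q i) else 0)"
    by (simp add: borel_measurable_poly)
  moreover have "(\<Prod>i\<in>UNIV. if p i = q i then fact (q i) else 0) = (if p = q then mfact p else (0::real))"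
    by (auto simp: mfact_def fun_eq_iff)
  moreover have "(exp (- (y \<bullet> x0) / \<sigma>\<^sup>2))\<^sup>2 *
      (\<Prod>i\<in>UNIV. poly (hermite (p i) * hermite (q i)) ((y $ i + x0 $ i) / \<sigma>))
      = hermite_obs \<sigma> x0 p y * hermite_obs \<sigma> x0 q y" for y
    by (simp add: hermite_obs_def power2_eq_square prod.distrib)
  ultimately show ?thesis by simp
qed

lemma has_bochner_integral_psi_hermite_obs:
  assumes "\<sigma> > 0"
  shows "has_bochner_integral (obs \<sigma> x0) (\<lambda>y. psi \<sigma> x0 x y * hermite_obs \<sigma> x0 p y) (mpow x p)"
proof -
  have "has_bochner_integral (obs \<sigma> x0) (\<lambda>y. (exp (- (y \<bullet> x0) / \<sigma>\<^sup>2))\<^sup>2 *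
      (\<Prod>i\<in>UNIV. exp (x $ i * ((y $ i + x0 $ i) / \<sigma>) - (x $ i)\<^sup>2 / 2) * poly (hermite (p i)) ((y $ i + x0 $ i) / \<sigma>)))
      (\<Prod>i\<in>UNIV. (x $ i) ^ p i)"
    by (rule has_bochner_integral_obs_weighted_prod[OF assms _ std_normal_exp_hermite]) measurable
  then show ?thesis
    by (simp add: psi_eq_prod[OF assms] hermite_obs_def power2_eq_square prod.distrib mpow_def mult_ac)
qed

lemma has_bochner_integral_psi_square:
  assumes "\<sigma> > 0"
  shows "has_bochner_integral (obs \<sigma> x0) (\<lambda>y. (psi \<sigma> x0 x y)\<^sup>2) (exp (\<Sum>i\<in>UNIV. (x $ i)\<^sup>2))"
proof -
  have "has_bochner_integral (obs \<sigma> x0) (\<lambda>y. (exp (- (y \<bullet> x0) / \<sigma>\<^sup>2))\<^sup>2 *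
      (\<Prod>i\<in>UNIV. (exp (x $ i * ((y $ i + x0 $ i) / \<sigma>) - (x $ i)\<^sup>2 / 2))\<^sup>2))
      (\<Prod>i\<in>UNIV. exp ((x $ i)\<^sup>2))"
    by (rule has_bochner_integral_obs_weighted_prod[OF assms _ std_normal_exp_square]) measurable
  then show ?thesis
    by (simp add: psi_eq_prod[OF assms] power_mult_distrib prod_power_distrib exp_sum)
qed

lemma sq_integrable_psi:
  assumes "\<sigma> > 0"
  shows "sq_integrable (obs \<sigma> x0) (psi \<sigma> x0 x)"
proof -
  have "psi \<sigma> x0 x \<in> borel_measurable borel"
    unfolding psi_def by measurable
  then show ?thesis
    using has_bochner_integral_psi_square[OF assms]
    by (auto simp: sq_integrable_def has_bochner_integral_iff)
qed

lemma orthonormal_hermite_obs: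
  fixes x0 :: "real^'n"
  assumes "\<sigma> > 0"
  shows "orthonormal_family (obs \<sigma> x0) (\<lambda>p y. hermite_obs \<sigma> x0 p y / sqrt (mfact p))"
proof -
  interpret prob_space "obs \<sigma> x0" by (rule prob_space_obs[OF assms])
  have int: "has_bochner_integral (obs \<sigma> x0)
      (\<lambda>y. (hermite_obs \<sigma> x0 p y / sqrt (mfact p)) * (hermite_obs \<sigma> x0 q y / sqrt (mfact q)))
      (if p = q then 1 else 0)" for p q :: "'n \<Rightarrow> nat"
    using has_bochner_integral_divide_zero[OF has_bochner_integral_hermite_obs[OF assms, of x0 p q],
        of "sqrt (mfact p) * sqrt (mfact q)"] mfact_pos[of p]
    by (simp split: if_splits)
  have [measurable]: "(\<lambda>y::real^'n. y $ i) \<in> borel_measurable borel" for i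
    by (intro borel_measurable_continuous_onI continuous_intros)
  have "(\<lambda>y. hermite_obs \<sigma> x0 p y / sqrt (mfact p)) \<in> borel_measurable borel" for p :: "'n \<Rightarrow> nat"
    unfolding hermite_obs_def by measurable
  then show ?thesis
    using int[THEN has_bochner_integral_integral_eq] int[THEN integrable.intros]
    by unfold_locales (simp_all only: sq_integrable_def power2_eq_square borel_measurable_obs simp_thms)
qed

section \<open>Change of measure and derivatives of \<open>psi\<close>\<close>

lemma gauss_pdf_psi:
  assumes "\<sigma> > 0"
  shows "gauss_pdf \<sigma> x y = gauss_pdf \<sigma> x0 y * psi \<sigma> x0 ((1 / \<sigma>) *\<^sub>R x) y / nu \<sigma> x0 x"
proof -
  have "- (norm (y - x))\<^sup>2 / (2 * \<sigma>\<^sup>2)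
      = - (norm (y - x0))\<^sup>2 / (2 * \<sigma>\<^sup>2)
        + ((y \<bullet> (\<sigma> *\<^sub>R ((1 / \<sigma>) *\<^sub>R x) - x0)) / \<sigma>\<^sup>2 + (x0 \<bullet> ((1 / \<sigma>) *\<^sub>R x)) / \<sigma> - (norm ((1 / \<sigma>) *\<^sub>R x))\<^sup>2 / 2)
        - (- (norm x0)\<^sup>2 / (2 * \<sigma>\<^sup>2) + (x \<bullet> x0) / \<sigma>\<^sup>2)"
    unfolding power2_norm_eq_inner using assms
    by (simp add: inner_diff_right inner_diff_left inner_commute field_simps power2_eq_square)
  then show ?thesis
    unfolding gauss_pdf_def psi_def nu_def
    by (simp only: exp_add exp_diff times_divide_eq_right times_divide_eq_left mult.assoc)
qed

lemma nu_pos: "0 < nu \<sigma> x0 x"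
  by (simp add: nu_def)

text \<open>The likelihood ratio is square-integrable at \<open>x0\<close>, so by Cauchy-Schwarz a
  finite second moment there yields a finite mean at every x, sparse or not.\<close>

lemma Ex_eq_integral_psi:
  assumes "\<sigma> > 0" and gh: "sq_integrable (obs \<sigma> x0) gh"
  shows "integrable (obs \<sigma> x) gh"
    and "Ex \<sigma> x gh = (1 / nu \<sigma> x0 x) * (\<integral>y. gh y * psi \<sigma> x0 ((1 / \<sigma>) *\<^sub>R x) y \<partial>obs \<sigma> x0)"
proof -
  let ?\<psi> = "psi \<sigma> x0 ((1 / \<sigma>) *\<^sub>R x)"
  let ?I = "\<integral>y. gh y * ?\<psi> y \<partial>obs \<sigma> x0"
  note psi = sq_integrable_psi[OF assms(1), of x0 "(1 / \<sigma>) *\<^sub>R x"]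
  have meas: "gh \<in> borel_measurable borel" "?\<psi> \<in> borel_measurable borel"
    using gh psi by (auto simp: sq_integrable_def)
  have "has_bochner_integral (obs \<sigma> x0) (\<lambda>y. gh y * ?\<psi> y) ?I"
    using sq_integrable_mult[OF gh psi] by (simp add: has_bochner_integral_iff)
  then have "has_bochner_integral lborel (\<lambda>y. gauss_pdf \<sigma> x0 y * (gh y * ?\<psi> y)) ?I"
    using meas by (subst (asm) has_bochner_integral_obs) auto
  then have "has_bochner_integral lborel
      (\<lambda>y. gauss_pdf \<sigma> x0 y * (gh y * ?\<psi> y) / nu \<sigma> x0 x) (?I / nu \<sigma> x0 x)"
    by (rule has_bochner_integral_divide_zero)
  then have "has_bochner_integral lborel (\<lambda>y. gauss_pdf \<sigma> x y * gh y) (?I / nu \<sigma> x0 x)"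
    by (simp add: gauss_pdf_psi[OF assms(1), of x _ x0] mult_ac)
  then have "has_bochner_integral (obs \<sigma> x) gh (?I / nu \<sigma> x0 x)"
    using meas by (subst has_bochner_integral_obs) auto
  then show "integrable (obs \<sigma> x) gh" "Ex \<sigma> x gh = (1 / nu \<sigma> x0 x) * ?I"
    by (auto simp: has_bochner_integral_iff Ex_def)
qed

lemma mpartial_psi:
  assumes "\<sigma> > 0"
  shows "mpartial p (\<lambda>x. psi \<sigma> x0 x y) 0 = hermite_obs \<sigma> x0 p y"
proof -
  define v where "v i = (y $ i + x0 $ i) / \<sigma>" for i
  \<comment> \<open>This is the n-th derivative of the generating function in s: its product rule is
    the recursion defining \<open>hermite\<close>, and s = 0 leaves the Hermite polynomial at
    \<open>v i\<close>.\<close>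
  define D where "D i n s = poly (hermite n) (v i - s) * exp (s * v i - s\<^sup>2 / 2)" for i n s
  have D: "(D i n has_field_derivative D i (Suc n) s) (at s)" for i n s
  proof -
    have "((\<lambda>s. poly (hermite n) (v i - s)) has_field_derivative - poly (pderiv (hermite n)) (v i - s)) (at s)"
      using DERIV_chain2[OF poly_DERIV, of "\<lambda>s. v i - s" "-1" s UNIV "hermite n"]
      by (auto intro!: derivative_eq_intros)
    then show ?thesis
      unfolding D_def by (auto intro!: derivative_eq_intros simp: algebra_simps)
  qed
  have psi: "(\<lambda>x. psi \<sigma> x0 x y) = (\<lambda>x. exp (- (y \<bullet> x0) / \<sigma>\<^sup>2) * (\<Prod>i\<in>UNIV. D i 0 (x $ i)))"
    by (simp add: psi_eq_prod[OF assms] D_def v_def)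
  show ?thesis
    unfolding mpartial_def psi foldr_partial_prod[of D, OF D] hermite_obs_def
    by (simp add: count_list_dirs D_def v_def)
qed

section \<open>Minimum variance estimation\<close>

lemma mpow_eq_0:
  assumes "x \<in> XS S" "p \<notin> MI S"
  shows "mpow x p = 0"
proof -
  have "\<not> {i. p i \<noteq> 0} \<subseteq> {i. x $ i \<noteq> 0}"
    using assms card_mono[of "{i. x $ i \<noteq> 0}" "{i. p i \<noteq> 0}"] by (auto simp: XS_def MI_def l0norm_def)
  then obtain i where "p i \<noteq> 0" "x $ i = 0" by blast
  then show ?thesis
    unfolding mpow_def by (intro prod_zero bexI[of _ i]) auto
qed

lemma scaleR_mem_XS:
  assumes "x \<in> XS S"
  shows "r *\<^sub>R x \<in> XS S"
proof -
  have "card {i. (r *\<^sub>R x) $ i \<noteq> 0} \<le> card {i. x $ i \<noteq> 0}"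
    by (rule card_mono) auto
  then show ?thesis using assms by (simp add: XS_def l0norm_def)
qed

text \<open>The represented series makes sense on the whole space and agrees with \<gamma> times
  \<open>nu\<close>, rescaled by \<sigma>, wherever the derivative looks. Uniqueness of the
  representation follows, since the left-hand side does not mention \<open>a\<close>.\<close>

lemma ax0_eq_of_rep:
  fixes x0 :: "real^'n"
  assumes "\<sigma> > 0" and rep: "rep \<sigma> S \<gamma> x0 a" and p: "p \<in> MI S"
  shows "ax0 \<sigma> \<gamma> x0 p = a p"
proof -
  define b where "b q = (if q \<in> MI S then a q / sqrt (mfact q) else 0)" for q
  have b: "entire_coeffs b"
    using rep unfolding b_def rep_def by (intro entire_coeffs_of_l2) simp
  have "mpartial p (\<lambda>x. \<gamma> (\<sigma> *\<^sub>R x) * nu \<sigma> x0 (\<sigma> *\<^sub>R x)) 0 = mpartial p (multi_series b) 0"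
  proof (rule mpartial_cong)
    fix x :: "real^'n" assume "{i. x $ i \<noteq> 0} \<subseteq> {i. p i \<noteq> 0}"
    then have "card {i. x $ i \<noteq> 0} \<le> S"
      using p card_mono[of "{i. p i \<noteq> 0}" "{i. x $ i \<noteq> 0}"] by (auto simp: MI_def)
    then have "\<sigma> *\<^sub>R x \<in> XS S"
      by (intro scaleR_mem_XS) (simp add: XS_def l0norm_def)
    then have "\<gamma> (\<sigma> *\<^sub>R x) = (1 / nu \<sigma> x0 (\<sigma> *\<^sub>R x)) * (\<Sum>\<^sub>\<infinity>q\<in>MI S. a q / sqrt (mfact q) * mpow x q)"
      using rep assms(1) by (simp add: rep_def)
    then have "\<gamma> (\<sigma> *\<^sub>R x) * nu \<sigma> x0 (\<sigma> *\<^sub>R x) = (\<Sum>\<^sub>\<infinity>q\<in>MI S. a q / sqrt (mfact q) * mpow x q)"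
      using nu_pos[of \<sigma> x0 "\<sigma> *\<^sub>R x"] by simp
    also have "\<dots> = multi_series b x"
      unfolding multi_series_def by (rule infsum_cong_neutral) (auto simp: b_def)
    finally show "\<gamma> (\<sigma> *\<^sub>R x) * nu \<sigma> x0 (\<sigma> *\<^sub>R x) = multi_series b x" .
  qed
  \<comment> \<open>The derivative contributes p!, the normalisations of \<open>ax0\<close> and of
    the series one root each.\<close>
  then have "ax0 \<sigma> \<gamma> x0 p = mfact p / (sqrt (mfact p) * sqrt (mfact p)) * a p"
    using p by (simp add: ax0_def mpartial_multi_series[OF b] b_def)
  then show ?thesis using mfact_pos[of p] by simp
qed

locale gaussian_model =
  fixes \<sigma> :: real and x0 :: "real^'n"
  assumes \<sigma>_pos: "\<sigma> > 0"
begin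

sublocale orthonormal_family "obs \<sigma> x0" "\<lambda>p y. hermite_obs \<sigma> x0 p y / sqrt (mfact p)"
  by (rule orthonormal_hermite_obs[OF \<sigma>_pos])

section \<open>Mean functions as power series\<close>

lemma coef_psi: "coef (psi \<sigma> x0 x) p = mpow x p / sqrt (mfact p)"
  using has_bochner_integral_integral_eq[OF has_bochner_integral_psi_hermite_obs[OF \<sigma>_pos, of x0 x p]]
  by (simp add: coef_def)

text \<open>The squared coefficients of \<open>psi \<sigma> x0 x\<close> form the exponential series
  in the squares of the coordinates, whose sum is its squared L^2 norm. Parseval's identity then
  applies against any square-integrable \<open>gh\<close>.\<close>

lemma psi_has_sum:
  assumes "sq_integrable (obs \<sigma> x0) gh"
  shows "((\<lambda>p. coef gh p / sqrt (mfact p) * mpow x p) has_sum (\<integral>y. gh y * psi \<sigma> x0 x y \<partial>obs \<sigma> x0)) UNIV"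
proof -
  have "(coef (psi \<sigma> x0 x) p)\<^sup>2 = (\<Prod>i\<in>UNIV. ((x $ i)\<^sup>2) ^ p i / fact (p i))" for p
    unfolding coef_psi power_divide real_sqrt_pow2[OF less_imp_le[OF mfact_pos]]
    by (simp add: prod_dividef mfact_def mpow_def prod_power_distrib mult.commute flip: power_mult)
  then have "(\<Sum>\<^sub>\<infinity>p. (coef (psi \<sigma> x0 x) p)\<^sup>2) = (\<integral>y. (psi \<sigma> x0 x y)\<^sup>2 \<partial>obs \<sigma> x0)"
    using infsumI[OF exp_multi_index_has_sum[of "\<lambda>i. (x $ i)\<^sup>2"]]
      has_bochner_integral_integral_eq[OF has_bochner_integral_psi_square[OF \<sigma>_pos, of x0 x]] by simp
  from parseval[OF assms sq_integrable_psi[OF \<sigma>_pos] this] show ?thesis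
    by (simp add: coef_psi mult.commute)
qed

lemma Ex_eq_series:
  assumes "sq_integrable (obs \<sigma> x0) gh" "x \<in> XS S"
  shows "Ex \<sigma> x gh = (1 / nu \<sigma> x0 x) *
    (\<Sum>\<^sub>\<infinity>p\<in>MI S. coef gh p / sqrt (mfact p) * mpow ((1 / \<sigma>) *\<^sub>R x) p)"
proof -
  let ?z = "(1 / \<sigma>) *\<^sub>R x"
  have "(\<integral>y. gh y * psi \<sigma> x0 ?z y \<partial>obs \<sigma> x0) = (\<Sum>\<^sub>\<infinity>p. coef gh p / sqrt (mfact p) * mpow ?z p)"
    using infsumI[OF psi_has_sum[OF assms(1)]] by simp
  also have "\<dots> = (\<Sum>\<^sub>\<infinity>p\<in>MI S. coef gh p / sqrt (mfact p) * mpow ?z p)"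
    using mpow_eq_0[OF scaleR_mem_XS[OF assms(2)]] by (intro infsum_cong_neutral) auto
  finally show ?thesis using Ex_eq_integral_psi(2)[OF \<sigma>_pos assms(1)] by simp
qed

lemma admissible_iff:
  "admissible \<sigma> S g c x0 gh \<longleftrightarrow>
    sq_integrable (obs \<sigma> x0) gh \<and> (\<forall>x\<in>XS S. Ex \<sigma> x gh = c x + g x)"
proof -
  have "Ex \<sigma> x gh - g x = c x \<longleftrightarrow> Ex \<sigma> x gh = c x + g x" for x by linarith
  then show ?thesis
    using Ex_eq_integral_psi(1)[OF \<sigma>_pos, of x0 gh]
    unfolding admissible_def sq_integrable_def borel_measurable_obs by blast
qed

lemma rep_coef:
  assumes "admissible \<sigma> S g c x0 gh"
  shows "rep \<sigma> S (\<lambda>x. c x + g x) x0 (coef gh)"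
proof -
  have gh: "sq_integrable (obs \<sigma> x0) gh"
    using assms by (simp add: admissible_iff)
  have bias: "c x + g x = Ex \<sigma> x gh" if "x \<in> XS S" for x
    using assms that by (auto simp: admissible_iff)
  show ?thesis
    unfolding rep_def using bessel(1)[OF gh] by (simp add: bias Ex_eq_series[OF gh])
qed

text \<open>The limit runs along subsets of \<open>MI S\<close>, so all other coefficients vanish.
  This leaves the mean on \<open>XS S\<close> unchanged and makes the second moment as small as
  Bessel's inequality allows.\<close>

lemma rep_imp_admissible:
  assumes "rep \<sigma> S (\<lambda>x. c x + g x) x0 a"
  obtains gh where "admissible \<sigma> S g c x0 gh"
    "(\<integral>y. (gh y)\<^sup>2 \<partial>obs \<sigma> x0) = (\<Sum>\<^sub>\<infinity>p\<in>MI S. (a p)\<^sup>2)"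
proof -
  have "(\<lambda>p. (a p)\<^sup>2) summable_on MI S"
    using assms by (simp add: rep_def)
  then obtain gh where gh: "sq_integrable (obs \<sigma> x0) gh"
      "((\<lambda>F. \<integral>y. (gh y - lincomb a F y)\<^sup>2 \<partial>obs \<sigma> x0) \<longlongrightarrow> 0) (finite_subsets_at_top (MI S))"
    by (rule riesz_fischer)
  have coef: "coef gh p = a p" if "p \<in> MI S" for p
    using coef_eq_of_tendsto[OF gh, of p] that by simp
  have "Ex \<sigma> x gh = c x + g x" if "x \<in> XS S" for x
  proof -
    have "(\<Sum>\<^sub>\<infinity>p\<in>MI S. coef gh p / sqrt (mfact p) * mpow ((1 / \<sigma>) *\<^sub>R x) p)
        = (\<Sum>\<^sub>\<infinity>p\<in>MI S. a p / sqrt (mfact p) * mpow ((1 / \<sigma>) *\<^sub>R x) p)"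
      by (rule infsum_cong) (simp add: coef)
    then show ?thesis
      unfolding Ex_eq_series[OF gh(1) that] using assms that by (simp add: rep_def)
  qed
  with gh(1) have "admissible \<sigma> S g c x0 gh" by (simp add: admissible_iff)
  then show thesis using norm_eq_of_tendsto[OF gh] by (rule that)
qed

lemma var_eq:
  assumes "admissible \<sigma> S g c x0 gh" "x0 \<in> XS S"
  shows "var \<sigma> x0 gh = (\<integral>y. (gh y)\<^sup>2 \<partial>obs \<sigma> x0) - (c x0 + g x0)\<^sup>2"
proof -
  have "Ex \<sigma> x0 gh = c x0 + g x0" using assms by (auto simp: admissible_iff)
  then show ?thesis unfolding var_def by (simp only: Ex_def)
qed

end

text \<open>Estimators matter only up to null sets, so (b) is rendered as existence of an
  \<open>LMV\<close> estimator together with mean-square convergence of the series to every such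
  estimator.\<close>

theorem theorem10:
  fixes S :: nat and \<sigma> :: real and g c :: "real^'n \<Rightarrow> real" and x0 :: "real^'n"
  assumes "1 \<le> S" and "S \<le> CARD('n)" and "\<sigma> > 0" and "x0 \<in> XS S"
  defines "\<gamma> \<equiv> (\<lambda>x. c x + g x)"
  shows "(valid \<sigma> S g c x0 \<longleftrightarrow> (\<exists>a. rep \<sigma> S \<gamma> x0 a))
    \<and> (\<forall>a b. rep \<sigma> S \<gamma> x0 a \<longrightarrow> rep \<sigma> S \<gamma> x0 b \<longrightarrow> (\<forall>p\<in>MI S. a p = b p))
    \<and> (valid \<sigma> S g c x0 \<longrightarrow>
         Mvar \<sigma> S g c x0 = (\<Sum>\<^sub>\<infinity>p\<in>MI S. (ax0 \<sigma> \<gamma> x0 p)\<^sup>2) - (\<gamma> x0)\<^sup>2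
       \<and> (\<exists>gh. LMV \<sigma> S g c x0 gh)
       \<and> (\<forall>gh. LMV \<sigma> S g c x0 gh \<longrightarrow>
            ((\<lambda>F. \<integral>y. (gh y - (\<Sum>p\<in>F. lmv_term \<sigma> \<gamma> x0 p y))\<^sup>2 \<partial>obs \<sigma> x0)
               \<longlongrightarrow> 0) (finite_subsets_at_top (MI S))))"
proof (intro conjI impI allI)
  interpret gaussian_model \<sigma> x0 by unfold_locales fact
  note ax0 = ax0_eq_of_rep[OF \<open>\<sigma> > 0\<close>, of S \<gamma> x0]
  show "valid \<sigma> S g c x0 \<longleftrightarrow> (\<exists>a. rep \<sigma> S \<gamma> x0 a)"
  proof
    assume "valid \<sigma> S g c x0"
    then show "\<exists>a. rep \<sigma> S \<gamma> x0 a"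
      using rep_coef unfolding valid_def \<gamma>_def by blast
  next
    assume "\<exists>a. rep \<sigma> S \<gamma> x0 a"
    then obtain a where "rep \<sigma> S \<gamma> x0 a" by blast
    then show "valid \<sigma> S g c x0"
      unfolding valid_def \<gamma>_def by (rule rep_imp_admissible) blast
  qed
  show "\<forall>p\<in>MI S. a p = b p" if "rep \<sigma> S \<gamma> x0 a" "rep \<sigma> S \<gamma> x0 b" for a b
    using ax0[OF that(1)] ax0[OF that(2)] by simp
  assume "valid \<sigma> S g c x0"
  then obtain gh0 where gh0: "admissible \<sigma> S g c x0 gh0" by (auto simp: valid_def)
  define T where "T = (\<Sum>\<^sub>\<infinity>p\<in>MI S. (ax0 \<sigma> \<gamma> x0 p)\<^sup>2)"
  have coef: "coef gh p = ax0 \<sigma> \<gamma> x0 p" if "admissible \<sigma> S g c x0 gh" "p \<in> MI S" for gh p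
    using ax0[OF rep_coef[OF that(1), folded \<gamma>_def] that(2)] by simp
  have T_eq: "(\<Sum>\<^sub>\<infinity>p\<in>MI S. (coef gh p)\<^sup>2) = T" if "admissible \<sigma> S g c x0 gh" for gh
    unfolding T_def by (rule infsum_cong) (simp add: coef[OF that])
  \<comment> \<open>\<open>gh1\<close> is rebuilt from the coefficients of \<open>gh0\<close> over
    \<open>MI S\<close> alone; it will attain the lower bound on the variance.\<close>
  obtain gh1 where gh1: "admissible \<sigma> S g c x0 gh1"
      "(\<integral>y. (gh1 y)\<^sup>2 \<partial>obs \<sigma> x0) = (\<Sum>\<^sub>\<infinity>p\<in>MI S. (coef gh0 p)\<^sup>2)"
    by (rule rep_imp_admissible[OF rep_coef[OF gh0]])
  note gh1_norm = gh1(2)[unfolded T_eq[OF gh0]]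
  have var_ge: "T - (\<gamma> x0)\<^sup>2 \<le> var \<sigma> x0 gh" if "admissible \<sigma> S g c x0 gh" for gh
    using bessel(2)[of gh "MI S"] T_eq[OF that] that[unfolded admissible_iff]
    unfolding var_eq[OF that \<open>x0 \<in> XS S\<close>] \<gamma>_def by simp
  have var1: "var \<sigma> x0 gh1 = T - (\<gamma> x0)\<^sup>2"
    unfolding var_eq[OF gh1(1) \<open>x0 \<in> XS S\<close>] \<gamma>_def gh1_norm ..
  have Mvar: "Mvar \<sigma> S g c x0 = T - (\<gamma> x0)\<^sup>2"
    unfolding Mvar_def
  proof (rule cInf_eq_minimum)
    show "T - (\<gamma> x0)\<^sup>2 \<in> var \<sigma> x0 ` {gh. admissible \<sigma> S g c x0 gh}"
      by (rule image_eqI[where x = gh1]) (simp_all add: gh1(1) var1)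
    show "T - (\<gamma> x0)\<^sup>2 \<le> v" if "v \<in> var \<sigma> x0 ` {gh. admissible \<sigma> S g c x0 gh}" for v
      using that var_ge by blast
  qed
  then show "Mvar \<sigma> S g c x0 = (\<Sum>\<^sub>\<infinity>p\<in>MI S. (ax0 \<sigma> \<gamma> x0 p)\<^sup>2) - (\<gamma> x0)\<^sup>2"
    by (simp add: T_def)
  show "\<exists>gh. LMV \<sigma> S g c x0 gh"
    using gh1(1) var1 Mvar by (auto simp: LMV_def)
  fix gh assume "LMV \<sigma> S g c x0 gh"
  then have gh: "admissible \<sigma> S g c x0 gh" "var \<sigma> x0 gh = T - (\<gamma> x0)\<^sup>2"
    by (auto simp: LMV_def Mvar)
  \<comment> \<open>Variance and second moment differ by the constant (\<gamma> x0)^2, so optimality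
    means equality in Bessel's inequality over \<open>MI S\<close>.\<close>
  then have "(\<Sum>\<^sub>\<infinity>p\<in>MI S. (coef gh p)\<^sup>2) = (\<integral>y. (gh y)\<^sup>2 \<partial>obs \<sigma> x0)"
    using T_eq[OF gh(1)] var_eq[OF gh(1) \<open>x0 \<in> XS S\<close>] by (simp add: \<gamma>_def)
  with gh(1) have "((\<lambda>F. \<integral>y. (gh y - lincomb (coef gh) F y)\<^sup>2 \<partial>obs \<sigma> x0) \<longlongrightarrow> 0) (finite_subsets_at_top (MI S))"
    by (intro lincomb_tendsto) (auto simp: admissible_iff)
  moreover have "\<forall>\<^sub>F F in finite_subsets_at_top (MI S).
      (\<integral>y. (gh y - lincomb (coef gh) F y)\<^sup>2 \<partial>obs \<sigma> x0)
      = (\<integral>y. (gh y - (\<Sum>p\<in>F. lmv_term \<sigma> \<gamma> x0 p y))\<^sup>2 \<partial>obs \<sigma> x0)"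
  proof (rule eventually_finite_subsets_at_top_weakI)
    fix F :: "('n \<Rightarrow> nat) set" assume "F \<subseteq> MI S"
    then have "lincomb (coef gh) F y = (\<Sum>p\<in>F. lmv_term \<sigma> \<gamma> x0 p y)" for y
      unfolding lincomb_def lmv_term_def mpartial_psi[OF \<open>\<sigma> > 0\<close>]
      by (intro sum.cong) (auto simp: coef[OF gh(1)])
    then show "(\<integral>y. (gh y - lincomb (coef gh) F y)\<^sup>2 \<partial>obs \<sigma> x0)
        = (\<integral>y. (gh y - (\<Sum>p\<in>F. lmv_term \<sigma> \<gamma> x0 p y))\<^sup>2 \<partial>obs \<sigma> x0)" by simp
  qed
  ultimately show "((\<lambda>F. \<integral>y. (gh y - (\<Sum>p\<in>F. lmv_term \<sigma> \<gamma> x0 p y))\<^sup>2 \<partial>obs \<sigma> x0)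
      \<longlongrightarrow> 0) (finite_subsets_at_top (MI S))"
    by (rule Lim_transform_eventually)
qed

end
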